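(* Let $\mathbb{K}$ be a field of characteristic zero. Any finite-dimensional quadratic symplectic Lie superalgebra $(\mathfrak{g},B,\omega)$ of filiform type over $\mathbb{K}$ is obtained from a quadratic symplectic Lie algebra by an elementary odd double extension followed by a (finite, possibly empty) sequence of generalized quadratic symplectic double extensions by the one-dimensional Lie superalgebra $(\mathbb{K}e)_{\bar 1}$.
   Context: A Lie superalgebra is a $\mathbb{Z}_2$-graded vector space $\mathfrak{g}=\mathfrak{g}_{\bar 0}\oplus\mathfrak{g}_{\bar 1}$ with an even bilinear bracket satisfying, for homogeneous $X,Y,Z$ of degrees $x,y,z$, $[X,Y]=-(-1)^{xy}[Y,X]$ and $(-1)^{xz}[X,[Y,Z]]+(-1)^{xy}[Y,[Z,X]]+(-1)^{yz}[Z,[X,Y]]=0$. A bilinear form $F$ is even if $F(\mathfrak{g}_{\bar 0},\mathfrak{g}_{\bar 1})=F(\mathfrak{g}_{\bar 1},\mathfrak{g}_{\bar 0})=\{0\}$. $(\mathfrak{g},B)$ is quadratic if $B$ is an even, non-degenerate, supersymmetric ($B(X,Y)=(-1)^{xy}B(Y,X)$), invariant ($B([X,Y],Z)=B(X,[Y,Z])$) bilinear form. A symplectic structure is an even, non-degenerate, skew-supersymmetric ($\omega(X,Y)=-(-1)^{xy}\omega(Y,X)$) bilinear form with $(-1)^{xz}\omega(X,[Y,Z])+(-1)^{yx}\omega(Y,[Z,X])+(-1)^{zy}\omega(Z,[X,Y])=0$. A quadratic symplectic Lie superalgebra $(\mathfrak{g},B,\omega)$ carries both; it is a quadratic symplectic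 Lie algebra when $\mathfrak{g}_{\bar 1}=\{0\}$. A superderivation of degree $d$ is a linear map $D$ homogeneous of degree $d$ with $D([X,Y])=[D(X),Y]+(-1)^{dx}[X,D(Y)]$; it is skew-supersymmetric if $B(D(X),Y)=-(-1)^{dx}B(X,D(Y))$ for $X\in\mathfrak{g}_x$. The symplectic structures on a quadratic $(\mathfrak{g},B)$ are exactly the forms $\omega=B(\delta(\cdot),\cdot)$ with $\delta$ a (unique) even invertible skew-supersymmetric superderivation. $\mathfrak{g}$ with $\dim\mathfrak{g}_{\bar 1}=m>0$ is of filiform type if there is a flag $\mathfrak{g}_{\bar 1}=V_m\supset\dots\supset V_1\supset V_0$ with $\dim V_i=i$ and $[\mathfrak{g}_{\bar 0},V_{i+1}]=V_i$ for $0\le i\le m-1$. Elementary odd double extension (symplectic version): start with a quadratic symplectic Lie algebra $(\mathfrak{h},B_{\mathfrak{h}},\omega_{\mathfrak{h}}=B_{\mathfrak{h}}(\delta_{\mathfrak{h}}\cdot,\cdot))$, $X_0\in\mathfrak{z}(\mathfrak{h})\setminus\{0\}$ (center) with $B_{\mathfrak{h}}(X_0,X_0)=0$ and $\delta_{\mathfrak{h}}(X_0)=\beta X_0$, $\beta\in\mathbb{K}\setminus\{0\}$. It is $\mathbb{K}e\oplus\mathfrak{h}\oplus\mathbb{K}e^*$ with $\mathfrak{h}$ even, $e,e^*$ odd, brackets $[e,e]=X_0$, $e^*$ central, $[e,X]=-B_{\mathfrak{h}}(X,X_0)e^*$, $[X,Y]=[X,Y]_{\mathfrak{h}}$ for $X,Y\in\mathfrak{h}$;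 supersymmetric form $B$ extending $B_{\mathfrak{h}}$ with $B(e^*,e)=1$, $B(\mathfrak{h},e)=B(\mathfrak{h},e^* )=\{0\}$, $B(e,e)=B(e^*,e^* )=0$; and $\omega=B(\delta\cdot,\cdot)$ where $\delta(e^* )=-\frac{\beta}{2}e^*$, $\delta(e)=\frac{\beta}{2}e$, $\delta|_{\mathfrak{h}}=\delta_{\mathfrak{h}}$. Generalized quadratic symplectic double extension by $(\mathbb{K}e)_{\bar 1}$: start with a quadratic symplectic Lie superalgebra of filiform type $(\mathfrak{h},B_{\mathfrak{h}},\omega_{\mathfrak{h}}=B_{\mathfrak{h}}(\delta_{\mathfrak{h}}\cdot,\cdot))$ with flag $\mathfrak{h}_{\bar 1}=W_n\supset\dots\supset W_0$, an odd skew-supersymmetric superderivation $D$ of $(\mathfrak{h},B_{\mathfrak{h}})$, $X_0\in\mathfrak{h}_{\bar 0}\setminus\{0\}$ with $D(X_0)=0$, $B_{\mathfrak{h}}(X_0,X_0)=0$, $D^2=\frac12[X_0,\cdot]_{\mathfrak{h}}$, $D(\mathfrak{h}_{\bar 0})$ containing an element of $W_n\setminus W_{n-1}$, and $\alpha\in\mathbb{K}\setminus\{0\}$, $\mu\in\mathbb{K}$, $A_1\in\mathfrak{h}_{\bar 1}$ with $\delta_{\mathfrak{h}}D-D\delta_{\mathfrak{h}}+\alpha D=[A_1,\cdot]_{\mathfrak{h}}$ and $D(A_1)=\alpha X_0+\frac12\delta_{\mathfrak{h}}(X_0)$. It is $\mathbb{K}e\oplus\mathfrak{h}\oplus\mathbb{K}e^*$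 with $e,e^*$ odd, brackets $[e,e]=X_0$, $e^*$ central, $[e,X]=D(X)-B_{\mathfrak{h}}(X,X_0)e^*$, $[X,Y]=[X,Y]_{\mathfrak{h}}-B_{\mathfrak{h}}(D(X),Y)e^*$ for $X,Y\in\mathfrak{h}$; supersymmetric form $B$ extending $B_{\mathfrak{h}}$ with $B(e^*,e)=1$, $B(\mathfrak{h},e)=B(\mathfrak{h},e^* )=\{0\}$, $B(e,e)=B(e^*,e^* )=0$; and $\omega=B(\delta\cdot,\cdot)$ where $\delta(e^* )=\alpha e^*$, $\delta(e)=\mu e^*+A_1-\alpha e$, $\delta(X)=\delta_{\mathfrak{h}}(X)-B_{\mathfrak{h}}(X,A_1)e^*$ for $X\in\mathfrak{h}$. "Obtained from" is understood up to Lie superalgebra isomorphisms preserving both forms. *)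

theory Defs
  imports Complex_Main "HOL-Library.Z2" "HOL-Library.Product_Plus"
begin

text \<open>
  The underlying space of a structure is a subspace, the direct sum of the two parts, of an ambient
  vector space given by the type of vectors and the scalar multiplication. Bracket, forms
  and linear maps only matter on that subspace. Degrees are elements of the two-element
  field \<^typ>\<open>bit\<close>.
\<close>

record ('k, 'v) super_struct =
  smul :: "'k \<Rightarrow> 'v \<Rightarrow> 'v"
  part :: "bit \<Rightarrow> 'v set"
  brk :: "'v \<Rightarrow> 'v \<Rightarrow> 'v"

record ('k, 'v) qs_struct = "('k, 'v) super_struct" +
  form :: "'v \<Rightarrow> 'v \<Rightarrow> 'k"
  symp :: "'v \<Rightarrow> 'v \<Rightarrow> 'k"

definition carr :: "('k, 'v::ab_group_add, 'm) super_struct_scheme \<Rightarrow> 'v set" where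
  "carr L = {x + y | x y. x \<in> part L 0 \<and> y \<in> part L 1}"

text \<open>\<open>sg d\<close> is $(-1)^d$.\<close>

definition sg :: "bit \<Rightarrow> 'k::comm_ring_1" where
  "sg d = (if d = 0 then 1 else - 1)"

definition linear_map_on ::
  "'v set \<Rightarrow> ('k \<Rightarrow> 'v \<Rightarrow> 'v) \<Rightarrow> ('k \<Rightarrow> 'w \<Rightarrow> 'w) \<Rightarrow> ('v::plus \<Rightarrow> 'w::plus) \<Rightarrow> bool" where
  "linear_map_on V s t f \<longleftrightarrow>
     (\<forall>x\<in>V. \<forall>y\<in>V. f (x + y) = f x + f y) \<and> (\<forall>c. \<forall>x\<in>V. f (s c x) = t c (f x))"

definition bilinear_map_on ::
  "'v set \<Rightarrow> ('k \<Rightarrow> 'v \<Rightarrow> 'v) \<Rightarrow> ('k \<Rightarrow> 'w \<Rightarrow> 'w) \<Rightarrow> ('v::plus \<Rightarrow> 'v \<Rightarrow> 'w::plus) \<Rightarrow> bool" where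
  "bilinear_map_on V s t f \<longleftrightarrow>
     (\<forall>x\<in>V. linear_map_on V s t (f x)) \<and> (\<forall>y\<in>V. linear_map_on V s t (\<lambda>x. f x y))"

locale lie_superalgebra =
  fixes L :: "('k::field_char_0, 'v::ab_group_add, 'm) super_struct_scheme" (structure)
  assumes vector_space: "vector_space (smul L)"
    and subspace_part: "module.subspace (smul L) (part L d)"
    and part_direct: "part L 0 \<inter> part L 1 = {0}"
    and brk_bilinear: "bilinear_map_on (carr L) (smul L) (smul L) (brk L)"
    and brk_part: "\<lbrakk>X \<in> part L x; Y \<in> part L y\<rbrakk> \<Longrightarrow> brk L X Y \<in> part L (x + y)"
    and brk_skew: "\<lbrakk>X \<in> part L x; Y \<in> part L y\<rbrakk> \<Longrightarrow> brk L X Y = smul L (- sg (x * y)) (brk L Y X)"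
    and brk_jacobi: "\<lbrakk>X \<in> part L x; Y \<in> part L y; Z \<in> part L z\<rbrakk> \<Longrightarrow>
      smul L (sg (x * z)) (brk L X (brk L Y Z)) + smul L (sg (x * y)) (brk L Y (brk L Z X))
        + smul L (sg (y * z)) (brk L Z (brk L X Y)) = 0"

definition even_form ::
  "('k::zero, 'v::ab_group_add, 'm) super_struct_scheme \<Rightarrow> ('v \<Rightarrow> 'v \<Rightarrow> 'k) \<Rightarrow> bool" where
  "even_form L F \<longleftrightarrow> (\<forall>X\<in>part L 0. \<forall>Y\<in>part L 1. F X Y = 0 \<and> F Y X = 0)"

definition nondegenerate_form ::
  "('k::zero, 'v::ab_group_add, 'm) super_struct_scheme \<Rightarrow> ('v \<Rightarrow> 'v \<Rightarrow> 'k) \<Rightarrow> bool" where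
  "nondegenerate_form L F \<longleftrightarrow> (\<forall>X\<in>carr L. (\<forall>Y\<in>carr L. F X Y = 0) \<longrightarrow> X = 0)"

locale quadratic_lie_superalgebra = lie_superalgebra L
  for L :: "('k::field_char_0, 'v::ab_group_add, 'm) qs_struct_scheme" (structure) +
  assumes form_bilinear: "bilinear_map_on (carr L) (smul L) (*) (form L)"
    and form_even: "even_form L (form L)"
    and form_nondegenerate: "nondegenerate_form L (form L)"
    and form_supersym: "\<lbrakk>X \<in> part L x; Y \<in> part L y\<rbrakk> \<Longrightarrow> form L X Y = sg (x * y) * form L Y X"
    and form_invariant: "\<lbrakk>X \<in> carr L; Y \<in> carr L; Z \<in> carr L\<rbrakk> \<Longrightarrow>
      form L (brk L X Y) Z = form L X (brk L Y Z)"

locale quadratic_symplectic_lie_superalgebra = quadratic_lie_superalgebra L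
  for L :: "('k::field_char_0, 'v::ab_group_add, 'm) qs_struct_scheme" (structure) +
  assumes symp_bilinear: "bilinear_map_on (carr L) (smul L) (*) (symp L)"
    and symp_even: "even_form L (symp L)"
    and symp_nondegenerate: "nondegenerate_form L (symp L)"
    and symp_skew: "\<lbrakk>X \<in> part L x; Y \<in> part L y\<rbrakk> \<Longrightarrow> symp L X Y = - sg (x * y) * symp L Y X"
    and symp_closed: "\<lbrakk>X \<in> part L x; Y \<in> part L y; Z \<in> part L z\<rbrakk> \<Longrightarrow>
      sg (x * z) * symp L X (brk L Y Z) + sg (y * x) * symp L Y (brk L Z X)
        + sg (z * y) * symp L Z (brk L X Y) = 0"

locale quadratic_symplectic_lie_algebra = quadratic_symplectic_lie_superalgebra L
  for L :: "('k::field_char_0, 'v::ab_group_add, 'm) qs_struct_scheme" (structure) +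
  assumes odd_part_zero: "part L 1 = {0}"

definition finite_dimensional ::
  "('k::field, 'v::ab_group_add, 'm) super_struct_scheme \<Rightarrow> bool" where
  "finite_dimensional L \<longleftrightarrow> (\<exists>S. finite S \<and> module.span (smul L) S = carr L)"

text \<open>
  \<open>filiform_flag L m V\<close>: the sets \<open>V 0, ..., V m\<close> form the flag. As usual, the bracket of two
  subspaces is the span of the brackets of their elements.
\<close>

definition filiform_flag ::
  "('k::field, 'v::ab_group_add, 'm) super_struct_scheme \<Rightarrow> nat \<Rightarrow> (nat \<Rightarrow> 'v set) \<Rightarrow> bool" where
  "filiform_flag L m V \<longleftrightarrow>
     m > 0 \<and> V m = part L 1 \<and>
     (\<forall>i\<le>m. module.subspace (smul L) (V i) \<and> vector_space.dim (smul L) (V i) = i) \<and>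
     (\<forall>i<m. V i \<subset> V (Suc i) \<and>
        module.span (smul L) {brk L X v | X v. X \<in> part L 0 \<and> v \<in> V (Suc i)} = V i)"

definition filiform_type ::
  "('k::field, 'v::ab_group_add, 'm) super_struct_scheme \<Rightarrow> bool" where
  "filiform_type L \<longleftrightarrow> (\<exists>m V. filiform_flag L m V)"

definition lie_center :: "('k, 'v::ab_group_add, 'm) super_struct_scheme \<Rightarrow> 'v set" where
  "lie_center L = {X \<in> carr L. \<forall>Y\<in>carr L. brk L X Y = 0}"

definition superderivation ::
  "('k::field, 'v::ab_group_add, 'm) super_struct_scheme \<Rightarrow> bit \<Rightarrow> ('v \<Rightarrow> 'v) \<Rightarrow> bool" where
  "superderivation L d D \<longleftrightarrow>
     linear_map_on (carr L) (smul L) (smul L) D \<and>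
     (\<forall>x. D ` part L x \<subseteq> part L (x + d)) \<and>
     (\<forall>x. \<forall>X\<in>part L x. \<forall>Y\<in>carr L.
        D (brk L X Y) = brk L (D X) Y + smul L (sg (d * x)) (brk L X (D Y)))"

definition skew_supersymmetric ::
  "('k::field, 'v::ab_group_add, 'm) qs_struct_scheme \<Rightarrow> bit \<Rightarrow> ('v \<Rightarrow> 'v) \<Rightarrow> bool" where
  "skew_supersymmetric L d D \<longleftrightarrow>
     (\<forall>x. \<forall>X\<in>part L x. \<forall>Y\<in>carr L. form L (D X) Y = - sg (d * x) * form L X (D Y))"

text \<open>\<open>\<delta>\<close> is the even invertible superderivation with \<open>\<omega> = B(\<delta>(\<cdot>),\<cdot>)\<close>.\<close>

definition symplectic_derivation ::
  "('k::field, 'v::ab_group_add, 'm) qs_struct_scheme \<Rightarrow> ('v \<Rightarrow> 'v) \<Rightarrow> bool" where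
  "symplectic_derivation L \<delta> \<longleftrightarrow>
     superderivation L 0 \<delta> \<and> skew_supersymmetric L 0 \<delta> \<and> bij_betw \<delta> (carr L) (carr L) \<and>
     (\<forall>X\<in>carr L. \<forall>Y\<in>carr L. symp L X Y = form L (\<delta> X) Y)"

definition qs_isomorphism ::
  "('k::field, 'v::ab_group_add) qs_struct \<Rightarrow> ('k, 'w::ab_group_add) qs_struct \<Rightarrow>
   ('v \<Rightarrow> 'w) \<Rightarrow> bool" where
  "qs_isomorphism L M f \<longleftrightarrow>
     bij_betw f (carr L) (carr M) \<and>
     linear_map_on (carr L) (smul L) (smul M) f \<and>
     (\<forall>d. f ` part L d = part M d) \<and>
     (\<forall>X\<in>carr L. \<forall>Y\<in>carr L.
        f (brk L X Y) = brk M (f X) (f Y) \<and>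
        form M (f X) (f Y) = form L X Y \<and>
        symp M (f X) (f Y) = symp L X Y)"

definition qs_isomorphic ::
  "('k::field, 'v::ab_group_add) qs_struct \<Rightarrow> ('k, 'w::ab_group_add) qs_struct \<Rightarrow> bool" where
  "qs_isomorphic L M \<longleftrightarrow> (\<exists>f. qs_isomorphism L M f)"

text \<open>
  The space $\mathbb{K}e \oplus \mathfrak{h} \oplus \mathbb{K}e^*$ with $e, e^*$ odd; the triple
  \<open>(a, X, b)\<close> stands for $a e + X + b e^*$. Supersymmetry forces $B(e, e^*) = -1$.
  The bracket and the derivation defining the symplectic form are parameters.
\<close>

definition ext_form ::
  "('k::field, 'v, 'm) qs_struct_scheme \<Rightarrow> 'k \<times> 'v \<times> 'k \<Rightarrow> 'k \<times> 'v \<times> 'k \<Rightarrow> 'k" where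
  "ext_form H = (\<lambda>(a, X, b) (a', Y, b'). form H X Y + b * a' - a * b')"

definition odd_ext ::
  "('k::field, 'v) qs_struct \<Rightarrow> ('k \<times> 'v \<times> 'k \<Rightarrow> 'k \<times> 'v \<times> 'k \<Rightarrow> 'k \<times> 'v \<times> 'k) \<Rightarrow>
   ('k \<times> 'v \<times> 'k \<Rightarrow> 'k \<times> 'v \<times> 'k) \<Rightarrow> ('k, 'k \<times> 'v \<times> 'k) qs_struct" where
  "odd_ext H br \<delta> =
     \<lparr>smul = (\<lambda>c (a, X, b). (c * a, smul H c X, c * b)),
      part = (\<lambda>d. if d = 0 then {0} \<times> part H 0 \<times> {0} else UNIV \<times> part H 1 \<times> UNIV),
      brk = br,
      form = ext_form H,
      symp = (\<lambda>u v. ext_form H (\<delta> u) v)\<rparr>"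

text \<open>
  Elementary odd double extension. The bracket is the bilinear extension of
  $[e,e] = X_0$, $[e,Y] = -B(Y,X_0)e^* = -[Y,e]$ and the bracket of $\mathfrak{h}$.
\<close>

definition elementary_ext ::
  "('k::field, 'v::ab_group_add) qs_struct \<Rightarrow> ('v \<Rightarrow> 'v) \<Rightarrow> 'v \<Rightarrow> 'k \<Rightarrow>
   ('k, 'k \<times> 'v \<times> 'k) qs_struct" where
  "elementary_ext H \<delta> X\<^sub>0 \<beta> = odd_ext H
     (\<lambda>(a, X, b) (a', Y, b').
        (0, smul H (a * a') X\<^sub>0 + brk H X Y, a' * form H X X\<^sub>0 - a * form H Y X\<^sub>0))
     (\<lambda>(a, X, b). ((\<beta> / 2) * a, \<delta> X, - (\<beta> / 2) * b))"

definition elementary_odd_double_extension ::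
  "('k::field_char_0, 'v::ab_group_add) qs_struct \<Rightarrow> ('k, 'w::ab_group_add) qs_struct \<Rightarrow> bool" where
  "elementary_odd_double_extension H G \<longleftrightarrow>
     quadratic_symplectic_lie_algebra H \<and>
     (\<exists>\<delta> X\<^sub>0 \<beta>.
        symplectic_derivation H \<delta> \<and>
        X\<^sub>0 \<in> lie_center H - {0} \<and> form H X\<^sub>0 X\<^sub>0 = 0 \<and>
        \<beta> \<noteq> 0 \<and> \<delta> X\<^sub>0 = smul H \<beta> X\<^sub>0 \<and>
        qs_isomorphic G (elementary_ext H \<delta> X\<^sub>0 \<beta>))"

text \<open>
  The parity automorphism: even minus odd component. It is used to write
  $[X,e] = -(-1)^x [e,X]$ for not necessarily homogeneous $X$.
\<close>

definition hcomp :: "('k, 'v::ab_group_add, 'm) super_struct_scheme \<Rightarrow> bit \<Rightarrow> 'v \<Rightarrow> 'v" where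
  "hcomp L d X = (THE Y. Y \<in> part L d \<and> X - Y \<in> part L (d + 1))"

definition parity_aut :: "('k, 'v::ab_group_add, 'm) super_struct_scheme \<Rightarrow> 'v \<Rightarrow> 'v" where
  "parity_aut L X = hcomp L 0 X - hcomp L 1 X"

text \<open>
  Generalized double extension. The bracket is the bilinear extension of $[e,e] = X_0$,
  $[e,Y] = D(Y) - B(Y,X_0)e^*$, $[X,e] = -(-1)^x [e,X]$ and
  $[X,Y] = [X,Y]_{\mathfrak{h}} - B(D(X),Y)e^*$; note that $B(X,X_0) = 0$ for odd $X$.
\<close>

definition generalized_ext ::
  "('k::field, 'v::ab_group_add) qs_struct \<Rightarrow> ('v \<Rightarrow> 'v) \<Rightarrow> ('v \<Rightarrow> 'v) \<Rightarrow> 'v \<Rightarrow> 'k \<Rightarrow> 'k \<Rightarrow> 'v \<Rightarrow>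
   ('k, 'k \<times> 'v \<times> 'k) qs_struct" where
  "generalized_ext H \<delta> D X\<^sub>0 \<alpha> \<mu> A\<^sub>1 = odd_ext H
     (\<lambda>(a, X, b) (a', Y, b').
        (0,
         smul H (a * a') X\<^sub>0 + smul H a (D Y) - smul H a' (D (parity_aut H X)) + brk H X Y,
         a' * form H X X\<^sub>0 - a * form H Y X\<^sub>0 - form H (D X) Y))
     (\<lambda>(a, X, b). (- \<alpha> * a, \<delta> X + smul H a A\<^sub>1, \<mu> * a - form H X A\<^sub>1 + \<alpha> * b))"

definition generalized_double_extension ::
  "('k::field_char_0, 'v::ab_group_add) qs_struct \<Rightarrow> ('k, 'w::ab_group_add) qs_struct \<Rightarrow> bool" where
  "generalized_double_extension H G \<longleftrightarrow>
     quadratic_symplectic_lie_superalgebra H \<and>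
     (\<exists>n W \<delta> D X\<^sub>0 \<alpha> \<mu> A\<^sub>1.
        filiform_flag H n W \<and>
        symplectic_derivation H \<delta> \<and>
        superderivation H 1 D \<and> skew_supersymmetric H 1 D \<and>
        X\<^sub>0 \<in> part H 0 - {0} \<and> D X\<^sub>0 = 0 \<and> form H X\<^sub>0 X\<^sub>0 = 0 \<and>
        (\<forall>X\<in>carr H. D (D X) = smul H (1 / 2) (brk H X\<^sub>0 X)) \<and>
        D ` part H 0 \<inter> (W n - W (n - 1)) \<noteq> {} \<and>
        \<alpha> \<noteq> 0 \<and> A\<^sub>1 \<in> part H 1 \<and>
        (\<forall>X\<in>carr H. \<delta> (D X) - D (\<delta> X) + smul H \<alpha> (D X) = brk H A\<^sub>1 X) \<and>
        D A\<^sub>1 = smul H \<alpha> X\<^sub>0 + smul H (1 / 2) (\<delta> X\<^sub>0) \<and>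
        qs_isomorphic G (generalized_ext H \<delta> D X\<^sub>0 \<alpha> \<mu> A\<^sub>1))"

end

theory Submission imports Defs begin

text \<open>
  The odd part of the center is a line spanned by some $e^*$. Its orthogonal complement in
  $\mathfrak{g}_{\bar 1}$ is the hyperplane $V_{m-1} = [\mathfrak{g}_{\bar 0}, \mathfrak{g}_{\bar 1}]$,
  and the derivation $\delta$ preserves the line. Choosing an odd $e \notin V_{m-1}$ with $B(e^*, e) = 1$
  and $[e,e] \neq 0$ splits $\mathfrak{g}$ as $\mathbb{K}e \oplus \mathfrak{h} \oplus \mathbb{K}e^*$ with
  $\mathfrak{h} \cong (e^*)^\perp / \mathbb{K}e^*$, and the $\mathfrak{h}$-components of $[e,\cdot]$, $[e,e]$
  and $\delta(e)$ are the data $D$, $X_0$, $A_1$ of a generalized double extension of $\mathfrak{h}$.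
  The flag descends to $\mathfrak{h}_{\bar 1}$, so one iterates until $\dim \mathfrak{g}_{\bar 1} = 2$. Then
  $\mathfrak{h}$ is even, $D = 0$ and $A_1 = 0$, and the extension is elementary once $e$ has been corrected
  by a multiple of $e^*$ to achieve $B(\delta(e), e) = 0$. Dimension one cannot occur, as $B$ is
  alternating on $\mathfrak{g}_{\bar 1}$.
\<close>

text \<open>Even elements annihilate V_1 because V_0 = 0; invariance of B extends this to odd
  elements, so V_1 is central. An odd element commuting with the even part is orthogonal to V_{m-1},
  which is spanned by brackets of even with odd elements. Both e^* and its image under \<delta> have
  this property, so they define functionals vanishing on a common hyperplane and are proportional.

  The square [e,e] becomes X_0, which must not vanish. The relations between D, X_0 and A_1 are the
  Jacobi identity for e and the Leibniz rule for \<delta>, solved by inverting 2 and 3.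

  The reflexive transitive closure in the theorem forces all structures of the chain to have one
  type, whereas an extension lives on triples. Hence the smaller algebra is a subspace of the given
  space and not a quotient, and triples enter only through an isomorphism. Finite dimension yields
  \<delta> once, at the start; every reduction inherits it, so the induction carries \<delta>
  along.\<close>

section \<open>Linear algebra\<close>

text \<open>These rules turn sums and products of degrees into bit operations, on which no rule below fires.\<close>

declare add_bit_eq_xor [simp del] mult_bit_eq_and [simp del]

lemma sg_simps [simp]: "sg 0 = 1" "sg 1 = - 1"
  by (simp_all add: sg_def)

context vector_space
begin

text \<open>Adjoining \<open>e\<close> to a basis of \<open>U\<close> gives \<open>n + 1\<close>
  independent vectors in a span of \<open>n + 1\<close> vectors, so the exchange bound leaves no
  room for \<open>x\<close>. Finiteness follows from positive \<open>card\<close>, since infinite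
  sets have \<open>card\<close> 0.\<close>

lemma hyperplane_decomposition:
  assumes U: "subspace U" "dim U = n" and W: "subspace W" "dim W = Suc n" "U \<subseteq> W"
    and e: "e \<in> W" "e \<notin> U" and x: "x \<in> W"
  obtains k where "x - scale k e \<in> U"
proof -
  obtain B where B: "B \<subseteq> U" "independent B" "U \<subseteq> span B" "card B = n"
    using basis_exists[of U] U(2) by metis
  obtain C where C: "C \<subseteq> W" "W \<subseteq> span C" "card C = Suc n"
    using basis_exists[of W] W(2) by metis
  have fin: "finite C"
    using C(3) by (intro card_ge_0_finite) simp
  have spanB: "span B = U"
    using B U(1) by (intro span_subspace)
  have "B \<subseteq> span C"
    using B(1) C(2) W(3) by blast
  then have finB: "finite B"
    using independent_span_bound[OF fin B(2)] by blast
  have eB: "independent (insert e B)" "e \<notin> B"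
    using B e spanB by (auto simp: independent_insert)
  have "x \<in> span (insert e B)"
  proof (rule ccontr)
    assume "x \<notin> span (insert e B)"
    then have "independent (insert x (insert e B))" "x \<notin> insert e B"
      using eB span_base[of x "insert e B"] by (auto simp: independent_insert)
    moreover have "insert x (insert e B) \<subseteq> span C"
      using x e B(1) C(2) W(3) by blast
    ultimately show False
      using independent_span_bound[OF fin, of "insert x (insert e B)"] eB finB B(4) C(3) by simp
  qed
  then show ?thesis
    using that by (auto simp: span_breakdown_eq spanB)
qed

text \<open>Dimension 0 alone is too weak, since an infinite basis has \<open>card\<close> 0 as
  well; containment in a space of positive dimension excludes that case.\<close>

lemma dim_zero_imp_trivial:
  assumes "subspace U" "dim U = 0" "U \<subseteq> W" "dim W = Suc n"
  shows "U = {0}"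
proof -
  obtain B where B: "B \<subseteq> U" "independent B" "U \<subseteq> span B" "card B = 0"
    using basis_exists[of U] assms(2) by metis
  obtain C where C: "W \<subseteq> span C" "card C = Suc n"
    using basis_exists[of W] assms(4) by metis
  have "finite C"
    using C(2) by (intro card_ge_0_finite) simp
  moreover have "B \<subseteq> span C"
    using B(1) C(1) assms(3) by blast
  ultimately have "finite B"
    using independent_span_bound[OF _ B(2)] by blast
  then have "B = {}"
    using B(4) by simp
  then show ?thesis
    using B(3) subspace_0[OF assms(1)] by auto
qed

text \<open>A basis of the kernel together with \<open>e\<close> is a basis of \<open>U\<close>,
  because subtracting \<open>f x\<close> times \<open>e\<close> moves \<open>x\<close> into the
  kernel. Linearity is assumed on \<open>U\<close> only, as forms are linear only on the
  carrier.\<close>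

lemma dim_kernel_of_functional:
  assumes U: "subspace U" "dim U = Suc n"
    and W: "subspace {x \<in> U. f x = 0}"
    and f: "\<And>x y. \<lbrakk>x \<in> U; y \<in> U\<rbrakk> \<Longrightarrow> f (x - y) = f x - f y" "\<And>c x. x \<in> U \<Longrightarrow> f (scale c x) = c * f x"
    and e: "e \<in> U" "f e = 1"
  shows "dim {x \<in> U. f x = 0} = n"
proof -
  let ?W = "{x \<in> U. f x = 0}"
  obtain B where B: "B \<subseteq> ?W" "independent B" "?W \<subseteq> span B" "card B = dim ?W"
    by (rule basis_exists)
  have spanB: "span B = ?W"
    using B(1,3) W by (rule span_subspace)
  then have e_span: "e \<notin> span B"
    using e(2) by simp
  then have "e \<notin> B"
    using span_base by blast
  have ind: "independent (insert e B)"
    using e_span B(2) by (rule independent_insertI)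
  have "U \<subseteq> span (insert e B)"
  proof
    fix x assume "x \<in> U"
    then have "x - scale (f x) e \<in> U"
      using e(1) U(1) by (intro subspace_diff subspace_scale)
    moreover have "f (x - scale (f x) e) = 0"
      using f(1)[OF \<open>x \<in> U\<close> subspace_scale[OF U(1) e(1)]] f(2)[OF e(1)] e(2) by simp
    ultimately have "x - scale (f x) e \<in> span B"
      unfolding spanB by blast
    then show "x \<in> span (insert e B)"
      unfolding span_breakdown_eq by blast
  qed
  moreover have "insert e B \<subseteq> U"
    using B(1) e(1) by blast
  ultimately have card: "card (insert e B) = Suc n"
    using basis_card_eq_dim[of "insert e B" U] ind U(2) by simp
  then have "finite (insert e B)"
    by (intro card_ge_0_finite) simp
  then show ?thesis
    using \<open>e \<notin> B\<close> B(4) card by simp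
qed

end

section \<open>Superderivations and quadratic structures\<close>

context lie_superalgebra
begin

sublocale vs: vector_space "smul L"
  by (rule vector_space)

abbreviation scale (infixr \<open>*s\<close> 75)
  where "c *s x \<equiv> smul L c x"

lemma carr_subspace: "vs.subspace (carr L)"
  unfolding carr_def using vs.subspace_sums[OF subspace_part subspace_part] .

lemma carr_closed [simp]:
  "0 \<in> carr L"
  "\<lbrakk>x \<in> carr L; y \<in> carr L\<rbrakk> \<Longrightarrow> x + y \<in> carr L"
  "\<lbrakk>x \<in> carr L; y \<in> carr L\<rbrakk> \<Longrightarrow> x - y \<in> carr L"
  "x \<in> carr L \<Longrightarrow> - x \<in> carr L"
  "x \<in> carr L \<Longrightarrow> c *s x \<in> carr L"
  using carr_subspace
  by (auto intro: vs.subspace_0 vs.subspace_add vs.subspace_diff vs.subspace_neg vs.subspace_scale)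

lemma part_closed [simp]:
  "0 \<in> part L d"
  "\<lbrakk>x \<in> part L d; y \<in> part L d\<rbrakk> \<Longrightarrow> x + y \<in> part L d"
  "\<lbrakk>x \<in> part L d; y \<in> part L d\<rbrakk> \<Longrightarrow> x - y \<in> part L d"
  "x \<in> part L d \<Longrightarrow> - x \<in> part L d"
  "x \<in> part L d \<Longrightarrow> c *s x \<in> part L d"
  using subspace_part[of d]
  by (auto intro: vs.subspace_0 vs.subspace_add vs.subspace_diff vs.subspace_neg vs.subspace_scale)

lemma part_carr [simp]: "x \<in> part L d \<Longrightarrow> x \<in> carr L"
  by (cases d) (force simp: carr_def)+

lemma carr_cases:
  assumes "x \<in> carr L"
  obtains x0 x1 where "x0 \<in> part L 0" "x1 \<in> part L 1" "x = x0 + x1"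
  using assms by (auto simp: carr_def)

lemma part_disjoint: "\<lbrakk>x \<in> part L 0; x \<in> part L 1\<rbrakk> \<Longrightarrow> x = 0"
  using part_direct by blast

lemma carr_cases_deg:
  assumes "x \<in> carr L"
  obtains y z where "y \<in> part L d" "z \<in> part L (d + 1)" "x = y + z"
  using assms by (cases d) (auto elim!: carr_cases simp: add.commute)

lemma bilinear_map_onD:
  assumes "bilinear_map_on (carr L) (smul L) t f"
  shows "\<lbrakk>x \<in> carr L; y \<in> carr L; z \<in> carr L\<rbrakk> \<Longrightarrow> f (x + y) z = f x z + f y z"
    "\<lbrakk>x \<in> carr L; y \<in> carr L; z \<in> carr L\<rbrakk> \<Longrightarrow> f z (x + y) = f z x + f z y"
    "\<lbrakk>x \<in> carr L; z \<in> carr L\<rbrakk> \<Longrightarrow> f (c *s x) z = t c (f x z)"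
    "\<lbrakk>x \<in> carr L; z \<in> carr L\<rbrakk> \<Longrightarrow> f z (c *s x) = t c (f z x)"
  using assms by (auto simp: bilinear_map_on_def linear_map_on_def)

lemma brk_add [simp]:
  assumes "x \<in> carr L" "y \<in> carr L" "z \<in> carr L"
  shows "brk L (x + y) z = brk L x z + brk L y z" "brk L z (x + y) = brk L z x + brk L z y"
  using bilinear_map_onD(1,2)[OF brk_bilinear] assms by auto

lemma brk_scale [simp]:
  assumes "x \<in> carr L" "z \<in> carr L"
  shows "brk L (c *s x) z = c *s brk L x z" "brk L z (c *s x) = c *s brk L z x"
  using bilinear_map_onD(3,4)[OF brk_bilinear] assms by auto

lemma brk_minus_zero [simp]:
  assumes "x \<in> carr L" "y \<in> carr L"
  shows "brk L (- x) y = - brk L x y" "brk L y (- x) = - brk L y x"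
    "brk L 0 y = 0" "brk L y 0 = 0"
  using brk_scale[of x y "- 1"] brk_scale[of x y 0] assms by auto

lemma brk_diff [simp]:
  assumes "x \<in> carr L" "y \<in> carr L" "z \<in> carr L"
  shows "brk L (x - y) z = brk L x z - brk L y z" "brk L z (x - y) = brk L z x - brk L z y"
  using brk_add[of x "- y" z] assms by auto

lemma brk_carr [simp]: "\<lbrakk>x \<in> carr L; y \<in> carr L\<rbrakk> \<Longrightarrow> brk L x y \<in> carr L"
  by (erule carr_cases, erule carr_cases) (simp add: part_carr[OF brk_part])

lemma brk_degrees:
  "\<lbrakk>x \<in> part L 0; y \<in> part L 0\<rbrakk> \<Longrightarrow> brk L x y \<in> part L 0"
  "\<lbrakk>x \<in> part L 0; y \<in> part L 1\<rbrakk> \<Longrightarrow> brk L x y \<in> part L 1"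
  "\<lbrakk>x \<in> part L 1; y \<in> part L 0\<rbrakk> \<Longrightarrow> brk L x y \<in> part L 1"
  "\<lbrakk>x \<in> part L 1; y \<in> part L 1\<rbrakk> \<Longrightarrow> brk L x y \<in> part L 0"
  using brk_part[of x 0 y 0] brk_part[of x 0 y 1] brk_part[of x 1 y 0] brk_part[of x 1 y 1] by auto

text \<open>This is the Jacobi identity in Leibniz form: skew symmetry moves \<open>X\<close> to the
  left in the second term and \<open>Z\<close> to the right in the third. The signs are checked for
  all eight choices of degrees.\<close>

lemma superderivation_ad:
  assumes X: "X \<in> part L d"
  shows "superderivation L d (brk L X)"
  unfolding superderivation_def
proof (intro conjI allI ballI)
  show "linear_map_on (carr L) (smul L) (smul L) (brk L X)"
    using X by (simp add: linear_map_on_def)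
  show "brk L X ` part L x \<subseteq> part L (x + d)" for x
    using brk_part[OF X] by (auto simp: add.commute[of x])
  fix y Y Z assume Y: "Y \<in> part L y" and Z: "Z \<in> carr L"
  have "brk L X (brk L Y Z) = brk L (brk L X Y) Z + sg (d * y) *s brk L Y (brk L X Z)"
    if Z: "Z \<in> part L z" for Z z
  proof -
    have "brk L Y (brk L Z X) = (- sg (z * d)) *s brk L Y (brk L X Z)"
      unfolding brk_skew[OF Z X] using X Y Z by (intro brk_scale(2)) auto
    moreover have "brk L Z (brk L X Y) = (- sg (z * (d + y))) *s brk L (brk L X Y) Z"
      using brk_skew[OF Z brk_part[OF X Y]] .
    ultimately show ?thesis
      using brk_jacobi[OF X Y Z]
      by (cases d; cases y; cases z) (simp_all add: algebra_simps eq_neg_iff_add_eq_0)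
  qed
  then show "brk L X (brk L Y Z) = brk L (brk L X Y) Z + sg (d * y) *s brk L Y (brk L X Z)"
    using X Y Z by (elim carr_cases) (simp add: vs.scale_right_distrib)
qed

lemma superderivationD:
  assumes "superderivation L d D"
  shows "\<lbrakk>x \<in> carr L; y \<in> carr L\<rbrakk> \<Longrightarrow> D (x + y) = D x + D y"
    and "x \<in> carr L \<Longrightarrow> D (c *s x) = c *s D x"
    and "x \<in> part L a \<Longrightarrow> D x \<in> part L (a + d)"
    and "\<lbrakk>x \<in> part L a; y \<in> carr L\<rbrakk> \<Longrightarrow> D (brk L x y) = brk L (D x) y + sg (d * a) *s brk L x (D y)"
    and "x \<in> carr L \<Longrightarrow> D x \<in> carr L"
    and "\<lbrakk>x \<in> carr L; y \<in> carr L\<rbrakk> \<Longrightarrow> D (x - y) = D x - D y"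
proof -
  show add: "\<lbrakk>x \<in> carr L; y \<in> carr L\<rbrakk> \<Longrightarrow> D (x + y) = D x + D y" for x y
    using assms by (auto simp: superderivation_def linear_map_on_def)
  show scale: "x \<in> carr L \<Longrightarrow> D (c *s x) = c *s D x" for c x
    using assms by (auto simp: superderivation_def linear_map_on_def)
  show part: "x \<in> part L a \<Longrightarrow> D x \<in> part L (a + d)" for x a
    using assms by (auto simp: superderivation_def)
  show "\<lbrakk>x \<in> part L a; y \<in> carr L\<rbrakk> \<Longrightarrow> D (brk L x y) = brk L (D x) y + sg (d * a) *s brk L x (D y)"
    using assms by (auto simp: superderivation_def)
  show "x \<in> carr L \<Longrightarrow> D x \<in> carr L"
    using part_carr[OF part] by (auto elim!: carr_cases simp: add)
  show "\<lbrakk>x \<in> carr L; y \<in> carr L\<rbrakk> \<Longrightarrow> D (x - y) = D x - D y"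
    using add[of x "- y"] scale[of y "- 1"] by simp
qed

lemma parity_aut_sum:
  assumes "x0 \<in> part L 0" "x1 \<in> part L 1"
  shows "parity_aut L (x0 + x1) = x0 - x1"
proof -
  have "hcomp L 0 (x0 + x1) = x0"
    unfolding hcomp_def
  proof (rule the_equality)
    fix Y assume Y: "Y \<in> part L 0 \<and> x0 + x1 - Y \<in> part L (0 + 1)"
    then have "(x0 + x1 - Y) - x1 \<in> part L 1"
      using assms by (simp only: part_closed(3) add_0)
    then show "Y = x0"
      using part_disjoint[of "x0 - Y"] Y assms by simp
  qed (use assms in auto)
  moreover have "hcomp L 1 (x0 + x1) = x1"
    unfolding hcomp_def
  proof (rule the_equality)
    fix Y assume Y: "Y \<in> part L 1 \<and> x0 + x1 - Y \<in> part L (1 + 1)"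
    then have "(x0 + x1 - Y) - x0 \<in> part L 0"
      using assms by (simp only: part_closed(3) one_add_one bit_2_eq_0)
    then show "Y = x1"
      using part_disjoint[of "x1 - Y"] Y assms by simp
  qed (use assms in auto)
  ultimately show ?thesis
    by (simp add: parity_aut_def)
qed

lemma functional_represented_if_vanishes_on_annihilator:
  assumes "finite T" "T \<subseteq> carr L"
    and F: "bilinear_map_on (carr L) (smul L) (*) F"
    and "linear_map_on (carr L) (smul L) (*) f"
    and "\<And>x. \<lbrakk>x \<in> carr L; \<And>t. t \<in> T \<Longrightarrow> F t x = 0\<rbrakk> \<Longrightarrow> f x = 0"
  shows "\<exists>z\<in>carr L. \<forall>x\<in>carr L. f x = F z x"
  using assms(1,2,4,5)
proof (induction T arbitrary: f rule: finite_induct)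
  case empty
  have "F 0 x = 0" if "x \<in> carr L" for x
    using bilinear_map_onD(3)[OF F that that, of 0] by simp
  with empty show ?case
    by (intro bexI[of _ 0]) auto
next
  case (insert t T)
  note [simp] = bilinear_map_onD[OF F]
  have t: "t \<in> carr L"
    using insert by simp
  have lin: "f (x + y) = f x + f y" "f (c *s x) = c * f x" if "x \<in> carr L" "y \<in> carr L" for c x y
    using insert.prems(2) that by (auto simp: linear_map_on_def)
  have diff: "f (x - y) = f x - f y" if "x \<in> carr L" "y \<in> carr L" for x y
    using lin(1)[of x "- y"] lin(2)[of y y "- 1"] that by simp
  show ?case
  proof (cases "\<forall>x\<in>carr L. (\<forall>s\<in>T. F s x = 0) \<longrightarrow> F t x = 0")
    case True
    then have "f x = 0" if "x \<in> carr L" "\<And>s. s \<in> T \<Longrightarrow> F s x = 0" for x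
      using insert.prems(3)[of x] that by blast
    then show ?thesis
      by (intro insert.IH[OF _ insert.prems(2)]) (use insert.prems(1) in auto)
  next
    case False
    then obtain u where u: "u \<in> carr L" "\<And>s. s \<in> T \<Longrightarrow> F s u = 0" "F t u \<noteq> 0"
      by auto
    define c where "c = f u / F t u"
    have "\<exists>z\<in>carr L. \<forall>x\<in>carr L. f x - c * F t x = F z x"
    proof (rule insert.IH)
      show "T \<subseteq> carr L"
        using insert by simp
      show "linear_map_on (carr L) (smul L) (*) (\<lambda>x. f x - c * F t x)"
        using t by (auto simp: linear_map_on_def lin algebra_simps)
      fix x assume x: "x \<in> carr L" "\<And>s. s \<in> T \<Longrightarrow> F s x = 0"
      \<comment> \<open>Moving \<open>x\<close> along \<open>u\<close> into the kernel of
        \<open>F t\<close> does not change the value of the corrected functional, which kills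
        \<open>u\<close>.\<close>
      define y where "y = x - (F t x / F t u) *s u"
      have F_diff: "F s (a - b) = F s a - F s b" if "s \<in> carr L" "a \<in> carr L" "b \<in> carr L" for s a b
        using bilinear_map_onD(2)[OF F, of a "- b" s] bilinear_map_onD(4)[OF F, of b s "- 1"] that by simp
      have "f y = 0"
      proof (rule insert.prems(3))
        show "y \<in> carr L"
          using x u by (simp add: y_def)
        show "F s y = 0" if "s \<in> insert t T" for s
        proof -
          have "s \<in> carr L"
            using that insert.prems by auto
          then show ?thesis
            using that x u by (auto simp: y_def F_diff)
        qed
      qed
      then show "f x - c * F t x = 0"
        using x u by (simp add: y_def diff lin c_def)
    qed
    then obtain z where "z \<in> carr L" "\<forall>x\<in>carr L. f x - c * F t x = F z x"
      by blast
    then show ?thesis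
      using t by (intro bexI[of _ "z + c *s t"]) (auto simp: algebra_simps)
  qed
qed

text \<open>Only 0 is annihilated by a whole finite spanning set, so the preceding lemma applies.
  \<open>F\<close> is arbitrary because both forms are needed: B to define \<delta>, and \<omega> to
  show that \<delta> is surjective.\<close>

lemma functional_represented:
  assumes fin: "finite_dimensional L"
    and F: "bilinear_map_on (carr L) (smul L) (*) F"
    and nondeg: "\<And>x. \<lbrakk>x \<in> carr L; \<And>y. y \<in> carr L \<Longrightarrow> F y x = 0\<rbrakk> \<Longrightarrow> x = 0"
    and f: "linear_map_on (carr L) (smul L) (*) f"
  shows "\<exists>z\<in>carr L. \<forall>x\<in>carr L. f x = F z x"
proof -
  obtain S where S: "finite S" "vs.span S = carr L"
    using fin by (auto simp: finite_dimensional_def)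
  have sub: "S \<subseteq> carr L"
    using S(2) vs.span_superset by blast
  have "f x = 0" if x: "x \<in> carr L" "\<And>s. s \<in> S \<Longrightarrow> F s x = 0" for x
  proof -
    have "F y x = 0" if "y \<in> carr L" for y
    proof -
      have "y \<in> vs.span S"
        using that by (simp add: S)
      then have "y \<in> carr L \<and> F y x = 0"
      proof (induction rule: vs.span_induct_alt)
        case base
        then show ?case
          using bilinear_map_onD(3)[OF F x(1) x(1), of 0] by simp
      next
        case (step c s y)
        then show ?case
          using x sub by (auto simp: bilinear_map_onD[OF F])
      qed
      then show ?thesis ..
    qed
    then have "x = 0"
      by (rule nondeg[OF x(1)])
    moreover have "f (0 *s 0) = 0 * f 0"
      using f unfolding linear_map_on_def by (meson carr_closed(1))
    ultimately show ?thesis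
      by simp
  qed
  then show ?thesis
    using functional_represented_if_vanishes_on_annihilator[OF S(1) sub F f] by blast
qed

end

context quadratic_lie_superalgebra
begin

lemma form_add [simp]:
  assumes "x \<in> carr L" "y \<in> carr L" "z \<in> carr L"
  shows "form L (x + y) z = form L x z + form L y z" "form L z (x + y) = form L z x + form L z y"
  using bilinear_map_onD(1,2)[OF form_bilinear] assms by auto

lemma form_scale [simp]:
  assumes "x \<in> carr L" "z \<in> carr L"
  shows "form L (c *s x) z = c * form L x z" "form L z (c *s x) = c * form L z x"
  using bilinear_map_onD(3,4)[OF form_bilinear] assms by auto

lemma form_minus_zero [simp]:
  assumes "x \<in> carr L" "y \<in> carr L"
  shows "form L (- x) y = - form L x y" "form L y (- x) = - form L y x"
    "form L 0 y = 0" "form L y 0 = 0"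
  using form_scale[of x y "- 1"] form_scale[of x y 0] assms by auto

lemma form_diff [simp]:
  assumes "x \<in> carr L" "y \<in> carr L" "z \<in> carr L"
  shows "form L (x - y) z = form L x z - form L y z" "form L z (x - y) = form L z x - form L z y"
  using form_add[of x "- y" z] assms by auto

lemma form_mixed_degree [simp]:
  "\<lbrakk>x \<in> part L 0; y \<in> part L 1\<rbrakk> \<Longrightarrow> form L x y = 0"
  "\<lbrakk>x \<in> part L 0; y \<in> part L 1\<rbrakk> \<Longrightarrow> form L y x = 0"
  using form_even by (auto simp: even_form_def)

lemma form_swap_odd: "\<lbrakk>x \<in> carr L; y \<in> part L 1\<rbrakk> \<Longrightarrow> form L x y = - form L y x"
  using form_supersym[of _ 1 y 1] by (auto elim!: carr_cases)

lemma form_swap_even: "\<lbrakk>x \<in> carr L; y \<in> part L 0\<rbrakk> \<Longrightarrow> form L x y = form L y x"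
  using form_supersym[of _ 0 y 0] by (auto elim!: carr_cases)

lemma form_odd_self: "x \<in> part L 1 \<Longrightarrow> form L x x = 0"
  using form_swap_odd[of x x] by (simp add: eq_neg_iff_add_eq_0)

lemma form_eq_zeroD: "\<lbrakk>x \<in> carr L; \<And>y. y \<in> carr L \<Longrightarrow> form L x y = 0\<rbrakk> \<Longrightarrow> x = 0"
  using form_nondegenerate by (auto simp: nondegenerate_form_def)

lemma form_eqD:
  "\<lbrakk>x \<in> carr L; y \<in> carr L; \<And>z. z \<in> carr L \<Longrightarrow> form L x z = form L y z\<rbrakk> \<Longrightarrow> x = y"
  using form_eq_zeroD[of "x - y"] by simp

lemma form_eq_zeroD_odd:
  "\<lbrakk>x \<in> part L 1; \<And>y. y \<in> part L 1 \<Longrightarrow> form L x y = 0\<rbrakk> \<Longrightarrow> x = 0"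
  by (rule form_eq_zeroD, simp, erule carr_cases) simp

lemma form_eq_zeroD_right:
  assumes "x \<in> carr L" "\<And>y. y \<in> carr L \<Longrightarrow> form L y x = 0"
  shows "x = 0"
proof (rule form_eq_zeroD[OF assms(1)])
  fix y assume "y \<in> carr L"
  then obtain y0 y1 where "y0 \<in> part L 0" "y1 \<in> part L 1" "y = y0 + y1"
    by (rule carr_cases)
  then show "form L x y = 0"
    using assms form_swap_odd[of x y1] form_swap_even[of x y0] by simp
qed

lemma skew_supersymmetric_ad:
  assumes X: "X \<in> part L d"
  shows "skew_supersymmetric L d (brk L X)"
  unfolding skew_supersymmetric_def
proof (intro allI ballI)
  fix y Y Z assume "Y \<in> part L y" "Z \<in> carr L"
  then show "form L (brk L X Y) Z = - sg (d * y) * form L Y (brk L X Z)"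
    using brk_skew[OF X, of Y y] X form_invariant[of Y X Z] by simp
qed

lemma skew_supersymmetricD:
  "\<lbrakk>skew_supersymmetric L d D; x \<in> part L a; y \<in> carr L\<rbrakk> \<Longrightarrow>
    form L (D x) y = - sg (d * a) * form L x (D y)"
  by (simp add: skew_supersymmetric_def)

end

section \<open>The derivation attached to the symplectic form\<close>

context quadratic_symplectic_lie_superalgebra
begin

text \<open>Sign bookkeeping for the Leibniz rule of \<delta>. With P = \<omega>(X,[Y,Z]), Q =
  \<omega>(Y,[X,Z]) and R = \<omega>(Z,[X,Y]), the assumption is closedness of \<omega>, and the
  conclusion is the Leibniz rule for [X,Y] paired with Z.\<close>

lemma sg_cyclic_identity:
  fixes P Q R :: 'k
  assumes "sg (x * z) * P + sg (x * y) * (- sg (x * z) * Q) + sg (z * y) * R = 0"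
  shows "- sg (z * (x + y)) * R = P - sg (x * y) * Q"
  using assms
  by (cases x; cases y; cases z) (auto simp: add_eq_0_iff)

lemma symp_add [simp]:
  assumes "x \<in> carr L" "y \<in> carr L" "z \<in> carr L"
  shows "symp L (x + y) z = symp L x z + symp L y z" "symp L z (x + y) = symp L z x + symp L z y"
  using bilinear_map_onD(1,2)[OF symp_bilinear] assms by auto

lemma symp_scale [simp]:
  assumes "x \<in> carr L" "z \<in> carr L"
  shows "symp L (c *s x) z = c * symp L x z" "symp L z (c *s x) = c * symp L z x"
  using bilinear_map_onD(3,4)[OF symp_bilinear] assms by auto

lemma symp_minus [simp]:
  assumes "x \<in> carr L" "y \<in> carr L"
  shows "symp L (- x) y = - symp L x y" "symp L y (- x) = - symp L y x"
  using symp_scale[of x y "- 1"] assms by auto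

lemma symp_diff [simp]:
  assumes "x \<in> carr L" "y \<in> carr L" "z \<in> carr L"
  shows "symp L (x - y) z = symp L x z - symp L y z" "symp L z (x - y) = symp L z x - symp L z y"
  using symp_add[of x "- y" z] assms by auto

lemma symp_mixed_degree [simp]:
  "\<lbrakk>x \<in> part L 0; y \<in> part L 1\<rbrakk> \<Longrightarrow> symp L x y = 0"
  "\<lbrakk>x \<in> part L 0; y \<in> part L 1\<rbrakk> \<Longrightarrow> symp L y x = 0"
  using symp_even by (auto simp: even_form_def)

lemma symp_swap_odd: "\<lbrakk>x \<in> carr L; y \<in> part L 1\<rbrakk> \<Longrightarrow> symp L x y = symp L y x"
  using symp_skew[of _ 1 y 1] by (auto elim!: carr_cases)

lemma symp_swap_even: "\<lbrakk>x \<in> carr L; y \<in> part L 0\<rbrakk> \<Longrightarrow> symp L x y = - symp L y x"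
  using symp_skew[of _ 0 y 0] by (auto elim!: carr_cases)

lemma symp_eq_zeroD: "\<lbrakk>x \<in> carr L; \<And>y. y \<in> carr L \<Longrightarrow> symp L x y = 0\<rbrakk> \<Longrightarrow> x = 0"
  using symp_nondegenerate by (auto simp: nondegenerate_form_def)

lemma symp_eq_zeroD_right:
  assumes "x \<in> carr L" "\<And>y. y \<in> carr L \<Longrightarrow> symp L y x = 0"
  shows "x = 0"
proof (rule symp_eq_zeroD[OF assms(1)])
  fix y assume "y \<in> carr L"
  then obtain y0 y1 where "y0 \<in> part L 0" "y1 \<in> part L 1" "y = y0 + y1"
    by (rule carr_cases)
  then show "symp L x y = 0"
    using assms symp_swap_odd[of x y1] symp_swap_even[of x y0] by simp
qed

lemma symp_linear: "x \<in> carr L \<Longrightarrow> linear_map_on (carr L) (smul L) (*) (symp L x)"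
  using symp_bilinear by (auto simp: bilinear_map_on_def)

lemma form_linear: "x \<in> carr L \<Longrightarrow> linear_map_on (carr L) (smul L) (*) (form L x)"
  using form_bilinear by (auto simp: bilinear_map_on_def)

text \<open>Representing each functional \<omega>(x, .) by B defines \<delta>. Uniqueness of the
  representing vector gives linearity, closedness of \<omega> gives the Leibniz rule, and
  non-degeneracy of \<omega> gives bijectivity.\<close>

lemma ex_symplectic_derivation:
  assumes fin: "finite_dimensional L"
  shows "\<exists>\<delta>. symplectic_derivation L \<delta>"
proof -
  have "\<exists>\<delta>. \<forall>x\<in>carr L. \<delta> x \<in> carr L \<and> (\<forall>y\<in>carr L. symp L x y = form L (\<delta> x) y)"
    using functional_represented[OF fin form_bilinear form_eq_zeroD_right symp_linear] by (intro bchoice) blast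
  then obtain \<delta> where \<delta>: "\<And>x. x \<in> carr L \<Longrightarrow> \<delta> x \<in> carr L"
    and symp: "\<And>x y. \<lbrakk>x \<in> carr L; y \<in> carr L\<rbrakk> \<Longrightarrow> symp L x y = form L (\<delta> x) y"
    by blast
  have eqI: "\<delta> x = z" if "x \<in> carr L" "z \<in> carr L" "\<And>y. y \<in> carr L \<Longrightarrow> symp L x y = form L z y"
    for x z
    using that \<delta> symp by (intro form_eqD) auto
  have add: "\<delta> (x + y) = \<delta> x + \<delta> y" if "x \<in> carr L" "y \<in> carr L" for x y
    using that \<delta> by (intro eqI) (auto simp: symp[symmetric])
  have scale: "\<delta> (c *s x) = c *s \<delta> x" if "x \<in> carr L" for c x
    using that \<delta> by (intro eqI) (auto simp: symp[symmetric])
  have part: "\<delta> x \<in> part L d" if x: "x \<in> part L d" for x d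
  proof -
    \<comment> \<open>The component \<open>z\<close> of the wrong degree is orthogonal to
      everything, since both forms are even.\<close>
    obtain y z where yz: "y \<in> part L d" "z \<in> part L (d + 1)" "\<delta> x = y + z"
      using \<delta> x by (blast elim: carr_cases_deg part_carr intro: part_carr)
    have "form L z w = 0" if "w \<in> carr L" for w
    proof -
      obtain a b where ab: "a \<in> part L d" "b \<in> part L (d + 1)" "w = a + b"
        using \<open>w \<in> carr L\<close> by (blast elim: carr_cases_deg)
      have "symp L x b = 0" "form L y b = 0" "form L z a = 0"
        using ab yz x by (cases d; simp)+
      then show ?thesis
        using symp[of x b] ab yz x by simp
    qed
    then have "z = 0"
      using yz by (intro form_eq_zeroD) auto
    then show ?thesis
      using yz by simp
  qed
  have "superderivation L 0 \<delta>"
    unfolding superderivation_def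
  proof (intro conjI allI ballI)
    show "linear_map_on (carr L) (smul L) (smul L) \<delta>"
      by (simp add: linear_map_on_def add scale)
    show "\<delta> ` part L x \<subseteq> part L (x + 0)" for x
      using part by auto
    fix x X Y assume X: "X \<in> part L x" and Y: "Y \<in> carr L"
    have hom: "\<delta> (brk L X Y) = brk L (\<delta> X) Y + brk L X (\<delta> Y)" if Y: "Y \<in> part L y" for Y y
    proof (rule eqI)
      fix Z assume Z: "Z \<in> carr L"
      have *: "symp L (brk L X Y) Z = form L (brk L (\<delta> X) Y + brk L X (\<delta> Y)) Z"
        if Z: "Z \<in> part L z" for Z z
      proof -
        have "form L (brk L (\<delta> X) Y) Z = symp L X (brk L Y Z)"
          using form_invariant[of "\<delta> X" Y Z] X Y Z \<delta> by (simp add: symp)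
        moreover have "form L (brk L X (\<delta> Y)) Z = - sg (x * y) * symp L Y (brk L X Z)"
          using brk_skew[OF X part[OF Y]] form_invariant[of "\<delta> Y" X Z] X Y Z \<delta> by (simp add: symp)
        moreover have "symp L Y (brk L Z X) = - sg (x * z) * symp L Y (brk L X Z)"
          using brk_skew[OF Z X] X Y Z by (simp add: mult.commute)
        moreover have "symp L (brk L X Y) Z = - sg (z * (x + y)) * symp L Z (brk L X Y)"
          using symp_skew[OF brk_part[OF X Y] Z] by (simp add: mult.commute)
        ultimately show ?thesis
          using sg_cyclic_identity[of x z "symp L X (brk L Y Z)" y "symp L Y (brk L X Z)" "symp L Z (brk L X Y)"]
            symp_closed[OF X Y Z] X Y Z \<delta> by (simp add: mult.commute[of y x])
      qed
      have "Z \<in> carr L" by fact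
      then show "symp L (brk L X Y) Z = form L (brk L (\<delta> X) Y + brk L X (\<delta> Y)) Z"
        using * X Y \<delta> by (elim carr_cases) (simp del: form_add(1))
    qed (use X Y \<delta> in auto)
    show "\<delta> (brk L X Y) = brk L (\<delta> X) Y + sg (0 * x) *s brk L X (\<delta> Y)"
      using Y hom X \<delta> by (elim carr_cases) (simp add: add)
  qed
  moreover have "skew_supersymmetric L 0 \<delta>"
    unfolding skew_supersymmetric_def
  proof (intro allI ballI)
    fix x X Y assume X: "X \<in> part L x" and Y: "Y \<in> carr L"
    have "form L (\<delta> X) Y = - form L X (\<delta> Y)" if Y: "Y \<in> part L y" for Y y
      using symp_skew[OF X Y] form_supersym[OF X part[OF Y]] symp[of X Y] symp[of Y X] X Y
      by simp
    then show "form L (\<delta> X) Y = - sg (0 * x) * form L X (\<delta> Y)"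
      using Y X \<delta> by (elim carr_cases) (simp add: add)
  qed
  moreover have "bij_betw \<delta> (carr L) (carr L)"
    unfolding bij_betw_def
  proof
    show "inj_on \<delta> (carr L)"
    proof (rule inj_onI)
      fix x y assume xy: "x \<in> carr L" "y \<in> carr L" "\<delta> x = \<delta> y"
      then have "symp L (x - y) z = 0" if "z \<in> carr L" for z
        using that symp[of x z] symp[of y z] by simp
      then have "x - y = 0"
        using xy by (intro symp_eq_zeroD) auto
      then show "x = y"
        by simp
    qed
    have "y \<in> \<delta> ` carr L" if y: "y \<in> carr L" for y
    proof -
      \<comment> \<open>Representing B(y, .) by \<omega> yields the preimage, because \<omega>(z, .)
        is B(\<delta> z, .).\<close>
      obtain z where "z \<in> carr L" "\<And>x. x \<in> carr L \<Longrightarrow> form L y x = symp L z x"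
        using functional_represented[OF fin symp_bilinear symp_eq_zeroD_right form_linear[OF y]] by blast
      with y show ?thesis
        by (intro image_eqI[of _ _ z] eqI[symmetric]) auto
    qed
    with \<delta> show "\<delta> ` carr L = carr L"
      by blast
  qed
  ultimately show ?thesis
    unfolding symplectic_derivation_def using symp by blast
qed

end

section \<open>Extensions and filiform flags\<close>

lemma carr_odd_ext: "carr (odd_ext H br d) = UNIV \<times> carr H \<times> UNIV"
proof
  show "carr (odd_ext H br d) \<subseteq> UNIV \<times> carr H \<times> UNIV"
    by (auto simp: carr_def odd_ext_def)
  show "UNIV \<times> carr H \<times> UNIV \<subseteq> carr (odd_ext H br d)"
  proof clarify
    fix a x b assume "x \<in> carr H"
    then obtain y z where "y \<in> part H 0" "z \<in> part H 1" "x = y + z"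
      by (auto simp: carr_def)
    then show "(a, x, b) \<in> carr (odd_ext H br d)"
      unfolding carr_def[of "odd_ext H br d"]
      by (intro CollectI exI[of _ "(0, y, 0)"] exI[of _ "(a, z, b)"]) (simp add: odd_ext_def)
  qed
qed

lemma odd_ext_simps [simp]:
  "smul (odd_ext H br d) c (a, x, b) = (c * a, smul H c x, c * b)"
  "part (odd_ext H br d) 0 = {0} \<times> part H 0 \<times> {0}"
  "part (odd_ext H br d) 1 = UNIV \<times> part H 1 \<times> UNIV"
  "brk (odd_ext H br d) = br"
  "form (odd_ext H br d) = ext_form H"
  "symp (odd_ext H br d) u v = ext_form H (d u) v"
  by (simp_all add: odd_ext_def)

text \<open>The natural map goes from triples to the given space, while the definition of an
  extension asks for the other direction. Closure is assumed separately so that the source need not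
  be known to be a Lie superalgebra.\<close>

lemma qs_isomorphism_sym:
  assumes f: "qs_isomorphism L M f"
    and closed: "\<And>x y. \<lbrakk>x \<in> carr L; y \<in> carr L\<rbrakk> \<Longrightarrow> x + y \<in> carr L"
      "\<And>c x. x \<in> carr L \<Longrightarrow> smul L c x \<in> carr L"
      "\<And>x y. \<lbrakk>x \<in> carr L; y \<in> carr L\<rbrakk> \<Longrightarrow> brk L x y \<in> carr L"
      "\<And>d. part L d \<subseteq> carr L"
  shows "qs_isomorphic M L"
proof -
  define g where "g = inv_into (carr L) f"
  have bij: "bij_betw f (carr L) (carr M)"
    using f by (simp add: qs_isomorphism_def)
  have gf: "g (f x) = x" if "x \<in> carr L" for x
    using bij that by (simp add: g_def bij_betw_inv_into_left)
  have ex: "\<exists>x\<in>carr L. y = f x" if "y \<in> carr M" for y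
    using bij that by (auto simp: bij_betw_def)
  have "qs_isomorphism M L g"
    unfolding qs_isomorphism_def
  proof (intro conjI allI ballI)
    show "bij_betw g (carr M) (carr L)"
      unfolding g_def using bij by (rule bij_betw_inv_into)
    have "g (f x + f y) = g (f x) + g (f y)" "g (smul M c (f x)) = smul L c (g (f x))"
      if "x \<in> carr L" "y \<in> carr L" for x y c
    proof -
      have "f x + f y = f (x + y)" "smul M c (f x) = f (smul L c x)"
        using f that by (auto simp: qs_isomorphism_def linear_map_on_def)
      then show "g (f x + f y) = g (f x) + g (f y)" "g (smul M c (f x)) = smul L c (g (f x))"
        using that gf closed(1,2) by simp_all
    qed
    then show "linear_map_on (carr M) (smul M) (smul L) g"
      unfolding linear_map_on_def using ex by blast
    show "g ` part M d = part L d" for d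
    proof -
      have "g ` part M d = (\<lambda>x. g (f x)) ` part L d"
        using f unfolding qs_isomorphism_def by (metis image_image)
      also have "\<dots> = (\<lambda>x. x) ` part L d"
        using closed(4)[of d] gf by (intro image_cong) auto
      finally show ?thesis
        by simp
    qed
    fix X Y assume "X \<in> carr M" "Y \<in> carr M"
    then obtain x y where xy: "x \<in> carr L" "y \<in> carr L" "X = f x" "Y = f y"
      using ex by blast
    then have "brk M X Y = f (brk L x y)" "form M X Y = form L x y" "symp M X Y = symp L x y"
      using f by (auto simp: qs_isomorphism_def)
    then show "g (brk M X Y) = brk L (g X) (g Y)" "form L (g X) (g Y) = form M X Y"
      "symp L (g X) (g Y) = symp M X Y"
      using gf[OF xy(1)] gf[OF xy(2)] gf[OF closed(3)[OF xy(1,2)]] xy(3,4) by simp_all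
  qed
  then show ?thesis
    by (auto simp: qs_isomorphic_def)
qed

context lie_superalgebra
begin

lemma filiform_flagD:
  assumes "filiform_flag L m V"
  shows "m > 0" "V m = part L 1" "i \<le> m \<Longrightarrow> vs.subspace (V i)" "i \<le> m \<Longrightarrow> vs.dim (V i) = i"
    "i < m \<Longrightarrow> V i \<subset> V (Suc i)"
    "i < m \<Longrightarrow> vs.span {brk L X v | X v. X \<in> part L 0 \<and> v \<in> V (Suc i)} = V i"
    "\<lbrakk>i < m; X \<in> part L 0; v \<in> V (Suc i)\<rbrakk> \<Longrightarrow> brk L X v \<in> V i"
proof -
  show span: "i < m \<Longrightarrow> vs.span {brk L X v | X v. X \<in> part L 0 \<and> v \<in> V (Suc i)} = V i"
    using assms by (simp add: filiform_flag_def)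
  show "\<lbrakk>i < m; X \<in> part L 0; v \<in> V (Suc i)\<rbrakk> \<Longrightarrow> brk L X v \<in> V i"
    unfolding span[symmetric] by (rule vs.span_base) blast
qed (use assms in \<open>auto simp: filiform_flag_def\<close>)

lemma filiform_flag_mono:
  assumes "filiform_flag L m V" "i \<le> j" "j \<le> m"
  shows "V i \<subseteq> V j"
  using assms(2,3)
proof (induction rule: dec_induct)
  case (step j)
  then show ?case
    using filiform_flagD(5)[OF assms(1), of j] by simp
qed simp

lemma filiform_flag_zero:
  assumes "filiform_flag L m V"
  shows "V 0 = {0}"
proof (rule vs.dim_zero_imp_trivial)
  show "V 0 \<subseteq> V 1" "vs.dim (V 1) = Suc 0"
    using filiform_flagD(1)[OF assms] filiform_flagD(4)[OF assms, of 1] filiform_flag_mono[OF assms, of 0 1]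
    by auto
qed (use filiform_flagD(3,4)[OF assms, of 0] in auto)

lemma filiform_flag_decomposition:
  assumes flag: "filiform_flag L (Suc m) V" and e: "e \<in> part L 1" "e \<notin> V m" and x: "x \<in> part L 1"
  obtains k v where "v \<in> V m" "x = v + k *s e"
proof -
  note fl = filiform_flagD[OF flag]
  have "vs.subspace (V m)" "vs.dim (V m) = m" "vs.subspace (V (Suc m))" "vs.dim (V (Suc m)) = Suc m"
    "V m \<subseteq> V (Suc m)" "e \<in> V (Suc m)" "x \<in> V (Suc m)"
    using fl(3,4)[of m] fl(3,4)[of "Suc m"] fl(5)[of m] fl(2) e(1) x by auto
  then obtain k where "x - k *s e \<in> V m"
    using vs.hyperplane_decomposition e(2) by blast
  then show ?thesis
    by (rule that[of "x - k *s e" k]) simp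
qed

text \<open>The top of the flag is V_{m+1} plus the line of \<open>e\<close>. If all brackets [X,e]
  were in V_m, the even part would map the top into V_m, but it generates V_{m+1}.\<close>

lemma filiform_brk_outside:
  assumes flag: "filiform_flag L (Suc (Suc m)) V" and e: "e \<in> part L 1" "e \<notin> V (Suc m)"
  obtains X where "X \<in> part L 0" "brk L X e \<notin> V m"
proof -
  note fl = filiform_flagD[OF flag]
  have False if *: "\<And>X. X \<in> part L 0 \<Longrightarrow> brk L X e \<in> V m"
  proof -
    have sub: "vs.subspace (V m)"
      by (rule fl(3)) simp
    have "brk L X v \<in> V m" if X: "X \<in> part L 0" and v: "v \<in> V (Suc (Suc m))" for X v
    proof -
      obtain k w where w: "w \<in> V (Suc m)" "v = w + k *s e"
        using filiform_flag_decomposition[OF flag e v[unfolded fl(2)]] .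
      have "w \<in> part L 1"
        using w(1) fl(2) fl(5)[of "Suc m"] by auto
      then have "brk L X v = brk L X w + k *s brk L X e"
        using w X e by simp
      then show ?thesis
        using *[OF X] fl(7)[of m X w] X w(1) sub
        by (simp add: vs.subspace_add vs.subspace_scale)
    qed
    then have "V (Suc m) \<subseteq> V m"
      unfolding fl(6)[of "Suc m", OF lessI, symmetric] using sub by (intro vs.span_minimal) auto
    then show False
      using fl(5)[of m] by auto
  qed
  then show ?thesis
    using that by blast
qed

lemma brk_swap_odd: "\<lbrakk>x \<in> part L 1; y \<in> part L 1\<rbrakk> \<Longrightarrow> brk L x y = brk L y x"
  using brk_skew[of x 1 y 1] by simp

lemma brk_swap_even: "\<lbrakk>x \<in> carr L; y \<in> part L 0\<rbrakk> \<Longrightarrow> brk L x y = - brk L y x"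
  using brk_skew[of _ 0 y 0] brk_skew[of _ 1 y 0] by (elim carr_cases) simp

end

context quadratic_lie_superalgebra
begin

text \<open>\<open>V m\<close> is spanned by brackets [X,y] with X even, and B(x,[X,y]) = B([x,X],y)
  = 0.\<close>

lemma orthogonal_if_centralizes_even:
  assumes x: "x \<in> part L 1" and cent: "\<And>X. X \<in> part L 0 \<Longrightarrow> brk L X x = 0"
    and flag: "filiform_flag L (Suc m) V"
  shows "v \<in> V m \<Longrightarrow> form L x v = 0"
proof -
  note fl = filiform_flagD[OF flag]
  assume "v \<in> V m"
  then have "v \<in> vs.span {brk L X v | X v. X \<in> part L 0 \<and> v \<in> V (Suc m)}"
    using fl(6)[of m] by simp
  then have "v \<in> carr L \<and> form L x v = 0"
  proof (induction rule: vs.span_induct_alt)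
    case base
    then show ?case
      using x by simp
  next
    case (step c u w)
    then obtain X y where u: "u = brk L X y" "X \<in> part L 0" "y \<in> part L 1"
      using fl(2) by auto
    have "form L x u = form L (brk L x X) y"
      using u x form_invariant[of x X y] by simp
    also have "\<dots> = 0"
      using u x cent[OF u(2)] brk_swap_even[of x X] by simp
    finally show ?case
      using step u x by simp
  qed
  then show ?thesis ..
qed

lemma ex_odd_with_nonzero_square:
  assumes flag: "filiform_flag L (Suc (Suc m)) V"
  obtains e where "e \<in> part L 1" "e \<notin> V (Suc m)" "brk L e e \<noteq> 0"
proof -
  note fl = filiform_flagD[OF flag]
  have Vpart: "V (Suc m) \<subseteq> part L 1"
    using fl(2) fl(5)[of "Suc m"] by auto
  have sub: "vs.subspace (V (Suc m))"
    by (rule fl(3)) simp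
  \<comment> \<open>Otherwise $[e,v] = 0$ by polarization, so that $B([X,e],y) = B(X,[e,y]) = 0$ for odd \<open>y\<close>.\<close>
  have False if *: "\<And>e. \<lbrakk>e \<in> part L 1; e \<notin> V (Suc m)\<rbrakk> \<Longrightarrow> brk L e e = 0"
  proof -
    obtain e where e: "e \<in> part L 1" "e \<notin> V (Suc m)"
      using fl(2) fl(5)[of "Suc m"] by auto
    have ev: "brk L e v = 0" if v: "v \<in> V (Suc m)" for v
    proof -
      have v1: "v \<in> part L 1"
        using v Vpart by blast
      \<comment> \<open>Both signs are needed, since nothing is known about [v,v] for
        \<open>v\<close> in the hyperplane: eliminating it between the two squares leaves 4 [e,v] =
        0.\<close>
      have "e + v \<notin> V (Suc m)" "e - v \<notin> V (Suc m)"
        using e(2) vs.subspace_diff[OF sub _ v, of "e + v"] vs.subspace_add[OF sub _ v, of "e - v"]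
        by auto
      then have "brk L (e + v) (e + v) = 0" "brk L (e - v) (e - v) = 0"
        using * e v1 by auto
      then have "brk L e v + brk L e v + brk L v v = 0" "brk L v v = brk L e v + brk L e v"
        using e v1 *[OF e] brk_swap_odd[of v e] by (simp_all add: algebra_simps)
      moreover have "(1 + 1 + (1 + 1)) *s brk L e v = brk L e v + brk L e v + (brk L e v + brk L e v)"
        by (simp only: vs.scale_left_distrib vs.scale_one)
      ultimately have "4 *s brk L e v = 0"
        by simp
      then show ?thesis
        by (simp add: vs.scale_eq_0_iff)
    qed
    have e_odd: "brk L e y = 0" if y: "y \<in> part L 1" for y
    proof -
      obtain k v where v: "v \<in> V (Suc m)" "y = v + k *s e"
        using filiform_flag_decomposition[OF flag e y] .
      then have "v \<in> part L 1"
        using Vpart by blast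
      then show ?thesis
        using v e ev[OF v(1)] *[OF e] by simp
    qed
    obtain X where X: "X \<in> part L 0" "brk L X e \<notin> V m"
      using filiform_brk_outside[OF flag e] .
    have "form L (brk L X e) y = 0" if "y \<in> part L 1" for y
      using that X e form_invariant[of X e y] e_odd[OF that] by simp
    then have "brk L X e = 0"
      using brk_degrees(2)[OF X(1) e(1)] by (intro form_eq_zeroD_odd)
    then show False
      using X(2) vs.subspace_0[OF fl(3)[of m]] by simp
  qed
  then show ?thesis
    using that by blast
qed

end

section \<open>The reduction by a central odd line\<close>

text \<open>\<open>e'\<close> plays the role of e^* and \<alpha> is its eigenvalue. The choice of
  \<open>e\<close> is left open up to normalization, so that it can be corrected afterwards.\<close>

locale odd_splitting = quadratic_symplectic_lie_superalgebra L
  for L :: "('k::field_char_0, 'v::ab_group_add) qs_struct" (structure) +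
  fixes \<delta> :: "'v \<Rightarrow> 'v" and e e' :: 'v and \<alpha> :: 'k
  assumes sder: "symplectic_derivation L \<delta>"
    and e_odd [simp]: "e \<in> part L 1"
    and e'_odd [simp]: "e' \<in> part L 1"
    and brk_e' [simp]: "x \<in> carr L \<Longrightarrow> brk L e' x = 0"
    and form_e'_e [simp]: "form L e' e = 1"
    and \<delta>_e' [simp]: "\<delta> e' = \<alpha> *s e'"
begin

text \<open>
  \<open>red\<close> realizes $(e^*)^\perp / \mathbb{K}e^*$ inside the ambient space as the orthogonal complement of
  \<open>e\<close> and \<open>e'\<close>. On $(e^*)^\perp$, \<open>Q\<close> is the projection onto this complement along \<open>e'\<close>. Since
  \<open>e'\<close> is central and orthogonal to \<open>red\<close>, \<open>Q\<close> is invisible inside brackets and forms.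
\<close>

definition Q :: "'v \<Rightarrow> 'v" where
  "Q x = x - form L x e *s e'"

definition red :: "('k, 'v) qs_struct" where
  "red = \<lparr>smul = smul L, part = (\<lambda>d. {x \<in> part L d. form L x e = 0 \<and> form L e' x = 0}),
     brk = (\<lambda>x y. Q (brk L x y)), form = form L, symp = symp L\<rparr>"

lemma red_simps [simp]:
  "smul red = smul L" "part red d = {x \<in> part L d. form L x e = 0 \<and> form L e' x = 0}"
  "brk red x y = Q (brk L x y)" "form red = form L" "symp red = symp L"
  by (simp_all add: red_def)

lemma ee'_carr [simp]: "e \<in> carr L" "e' \<in> carr L"
  using part_carr[OF e_odd] part_carr[OF e'_odd] by auto

lemma brk_e'_right [simp]: "x \<in> carr L \<Longrightarrow> brk L x e' = 0"
proof (erule carr_cases)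
  fix x0 x1 assume x: "x0 \<in> part L 0" "x1 \<in> part L 1" "x = x0 + x1"
  then show "brk L x e' = 0"
    using brk_skew[OF x(1) e'_odd] brk_skew[OF x(2) e'_odd] by simp
qed

lemma form_ee' [simp]: "form L e e = 0" "form L e' e' = 0" "form L e e' = - 1"
  using form_odd_self[OF e_odd] form_odd_self[OF e'_odd] form_swap_odd[of e e'] by auto

lemma form_e'_brk [simp]: "\<lbrakk>x \<in> carr L; y \<in> carr L\<rbrakk> \<Longrightarrow> form L e' (brk L x y) = 0"
  using form_invariant[of e' x y] by simp

lemma carr_red: "carr red = {x \<in> carr L. form L x e = 0 \<and> form L e' x = 0}" (is "_ = ?R")
proof
  show "carr red \<subseteq> ?R"
    by (auto simp: carr_def[of red])
  show "?R \<subseteq> carr red"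
  proof
    fix x assume x: "x \<in> ?R"
    then obtain x0 x1 where "x0 \<in> part L 0" "x1 \<in> part L 1" "x = x0 + x1"
      by (blast elim: carr_cases)
    with x have "x0 \<in> part red 0" "x1 \<in> part red 1" "x = x0 + x1"
      by auto
    then show "x \<in> carr red"
      unfolding carr_def[of red] by blast
  qed
qed

lemma red_orth:
  assumes "x \<in> carr red"
  shows "form L x e = 0" "form L e x = 0" "form L x e' = 0" "form L e' x = 0" "x \<in> carr L"
  using assms form_swap_odd[of x e] form_swap_odd[of x e'] by (auto simp: carr_red)

lemma part_red_carr: "x \<in> part red d \<Longrightarrow> x \<in> carr red"
  by (auto simp: carr_red)

lemma Q_linear:
  "\<lbrakk>x \<in> carr L; y \<in> carr L\<rbrakk> \<Longrightarrow> Q (x + y) = Q x + Q y"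
  "x \<in> carr L \<Longrightarrow> Q (c *s x) = c *s Q x"
  "\<lbrakk>x \<in> carr L; y \<in> carr L\<rbrakk> \<Longrightarrow> Q (x - y) = Q x - Q y"
  by (simp_all add: Q_def vs.scale_left_distrib vs.scale_left_diff_distrib vs.scale_right_diff_distrib)

lemma Q_e' [simp]: "Q e' = 0" and Q_0 [simp]: "Q 0 = 0"
  by (simp_all add: Q_def)

lemma Q_id: "form L x e = 0 \<Longrightarrow> Q x = x"
  by (simp add: Q_def)

lemma Q_even: "x \<in> part L 0 \<Longrightarrow> Q x = x"
  by (simp add: Q_id)

lemma Q_part: "x \<in> part L d \<Longrightarrow> Q x \<in> part L d"
  by (cases d) (auto simp: Q_even, simp add: Q_def)

lemma Q_carr [simp]: "x \<in> carr L \<Longrightarrow> Q x \<in> carr L"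
  by (simp add: Q_def)

lemma brk_Q [simp]: "\<lbrakk>x \<in> carr L; y \<in> carr L\<rbrakk> \<Longrightarrow> brk L (Q x) y = brk L x y"
  "\<lbrakk>x \<in> carr L; y \<in> carr L\<rbrakk> \<Longrightarrow> brk L x (Q y) = brk L x y"
  by (simp_all add: Q_def)

lemma form_Q: "\<lbrakk>x \<in> carr L; y \<in> carr red\<rbrakk> \<Longrightarrow> form L (Q x) y = form L x y"
  "\<lbrakk>x \<in> carr L; y \<in> carr red\<rbrakk> \<Longrightarrow> form L y (Q x) = form L y x"
  by (simp_all add: Q_def red_orth)

lemma Q_part_red: "\<lbrakk>x \<in> part L d; form L e' x = 0\<rbrakk> \<Longrightarrow> Q x \<in> part red d"
  by (simp add: Q_part) (simp add: Q_def)

lemma Q_carr_red: "\<lbrakk>x \<in> carr L; form L e' x = 0\<rbrakk> \<Longrightarrow> Q x \<in> carr red"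
  by (simp add: carr_red) (simp add: Q_def)

lemma sderD:
  "superderivation L 0 \<delta>" "skew_supersymmetric L 0 \<delta>" "bij_betw \<delta> (carr L) (carr L)"
  "\<lbrakk>x \<in> carr L; y \<in> carr L\<rbrakk> \<Longrightarrow> symp L x y = form L (\<delta> x) y"
  using sder by (auto simp: symplectic_derivation_def)

lemmas \<delta>_simps [simp] = superderivationD(1,2,5,6)[OF sderD(1)]

lemma \<delta>_part: "x \<in> part L d \<Longrightarrow> \<delta> x \<in> part L d"
  using superderivationD(3)[OF sderD(1)] by simp

lemma \<delta>_brk: "\<lbrakk>x \<in> carr L; y \<in> carr L\<rbrakk> \<Longrightarrow> \<delta> (brk L x y) = brk L (\<delta> x) y + brk L x (\<delta> y)"
  by (erule carr_cases) (simp add: superderivationD(4)[OF sderD(1)])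

lemma form_\<delta>: "\<lbrakk>x \<in> carr L; y \<in> carr L\<rbrakk> \<Longrightarrow> form L (\<delta> x) y = - form L x (\<delta> y)"
  by (erule carr_cases) (simp add: skew_supersymmetricD[OF sderD(2)])

lemma \<alpha>_nonzero: "\<alpha> \<noteq> 0"
proof
  assume "\<alpha> = 0"
  then have "\<delta> e' = \<delta> 0"
    using \<delta>_simps(2)[of 0 0] by simp
  then have "e' = 0"
    using sderD(3) by (auto simp: bij_betw_def inj_on_def)
  then show False
    using form_e'_e by simp
qed

text \<open>Since \<open>e\<close> and \<open>e'\<close> are isotropic and paired to 1, pairing with
  \<open>e'\<close> reads off the coefficient of \<open>e\<close>, and pairing with \<open>e\<close>
  that of \<open>e'\<close>.\<close>

lemma decompose:
  assumes "x \<in> carr L"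
  obtains y where "y \<in> carr red" "x = form L e' x *s e + y + form L x e *s e'"
proof
  show "x - form L e' x *s e - form L x e *s e' \<in> carr red"
    using assms form_swap_odd[of x e] by (simp add: carr_red)
qed simp

lemma red_qs: "quadratic_symplectic_lie_superalgebra red"
proof (intro quadratic_symplectic_lie_superalgebra.intro quadratic_lie_superalgebra.intro
    lie_superalgebra.intro quadratic_lie_superalgebra_axioms.intro
    quadratic_symplectic_lie_superalgebra_axioms.intro)
  note [simp] = Q_linear
  show "vector_space (smul red)"
    by (simp add: vector_space)
  have sub: "vs.subspace (part red d)" for d
    by (rule vs.subspaceI) auto
  then show "module.subspace (smul red) (part red d)" for d
    by simp
  show "part red 0 \<inter> part red 1 = {0}"
    using part_direct by auto
  show "bilinear_map_on (carr red) (smul red) (smul red) (brk red)"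
    by (simp add: bilinear_map_on_def linear_map_on_def carr_red)
  show "brk red X Y \<in> part red (x + y)" if "X \<in> part red x" "Y \<in> part red y" for X x Y y
    unfolding red_simps(3) using that brk_part[of X x Y y] by (intro Q_part_red) auto
  show "brk red X Y = smul red (- sg (x * y)) (brk red Y X)"
    if "X \<in> part red x" "Y \<in> part red y" for X x Y y
  proof -
    have XY: "X \<in> part L x" "Y \<in> part L y"
      using that by auto
    then show ?thesis
      using Q_linear(2)[of "brk L Y X" "- sg (x * y)"] brk_skew[OF XY] by simp
  qed
  show "smul red (sg (x * z)) (brk red X (brk red Y Z)) + smul red (sg (x * y)) (brk red Y (brk red Z X))
        + smul red (sg (y * z)) (brk red Z (brk red X Y)) = 0"
    if "X \<in> part red x" "Y \<in> part red y" "Z \<in> part red z" for X x Y y Z z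
  proof -
    have XYZ: "X \<in> part L x" "Y \<in> part L y" "Z \<in> part L z"
      using that by auto
    then have [simp]: "X \<in> carr L" "Y \<in> carr L" "Z \<in> carr L"
      by auto
    show ?thesis
      \<comment> \<open>It suffices to project the Jacobi identity of \<open>L\<close>, because the
        inner projections disappear by \<open>brk_Q\<close>.\<close>
      using arg_cong[OF brk_jacobi[OF XYZ], of Q] by simp
  qed
  show "bilinear_map_on (carr red) (smul red) (*) (form red)"
    "bilinear_map_on (carr red) (smul red) (*) (symp red)"
    by (simp_all add: bilinear_map_on_def linear_map_on_def carr_red)
  show "even_form red (form red)" "even_form red (symp red)"
    by (simp_all add: even_form_def)
  \<comment> \<open>Testing against \<open>red\<close> is enough: \<open>x\<close> is already
    orthogonal to \<open>e\<close> and \<open>e'\<close>.\<close>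
  have nondeg: "x = 0" if x: "x \<in> carr red" and 0: "\<And>y. y \<in> carr red \<Longrightarrow> form L x y = 0" for x
  proof (rule form_eq_zeroD)
    fix y assume y: "y \<in> carr L"
    then obtain z where z: "z \<in> carr red" "y = form L e' y *s e + z + form L y e *s e'"
      by (rule decompose)
    have "form L x (form L e' y *s e + z + form L y e *s e') = 0"
      using x 0[OF z(1)] by (simp add: red_orth[OF x] red_orth[OF z(1)])
    then show "form L x y = 0"
      using z(2) by simp
  qed (use x in \<open>auto simp: red_orth\<close>)
  then show "nondegenerate_form red (form red)"
    by (auto simp: nondegenerate_form_def)
  show "nondegenerate_form red (symp red)"
    unfolding nondegenerate_form_def
  proof (intro ballI impI)
    fix x assume x: "x \<in> carr red" and 0: "\<forall>y\<in>carr red. symp red x y = 0"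
    \<comment> \<open>The image of \<open>x\<close> under \<delta> stays orthogonal to
      \<open>e'\<close>, and its projection is orthogonal to all of \<open>red\<close>, hence 0. So
      this image, and with it \<open>x\<close>, is a multiple of \<open>e'\<close>; but
      \<open>x\<close> is orthogonal to \<open>e\<close>.\<close>
    have e'x: "form L e' (\<delta> x) = 0"
      using form_\<delta>[of e' x] red_orth[OF x] by simp
    have "Q (\<delta> x) = 0"
      using x 0 e'x by (intro nondeg Q_carr_red) (auto simp: form_Q red_orth sderD)
    then have *: "\<delta> x = form L (\<delta> x) e *s e'"
      by (simp add: Q_def)
    define k where "k = form L (\<delta> x) e / \<alpha>"
    have "\<delta> x = \<delta> (k *s e')"
      using * \<alpha>_nonzero by (simp add: k_def)
    then have "x = k *s e'"
      using sderD(3) red_orth[OF x] by (auto simp: bij_betw_def inj_on_def)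
    then show "x = 0"
      using red_orth(1)[OF x] by simp
  qed
  show "form red X Y = sg (x * y) * form red Y X" if "X \<in> part red x" "Y \<in> part red y" for X x Y y
    using that form_supersym by simp
  show "symp red X Y = - sg (x * y) * symp red Y X" if "X \<in> part red x" "Y \<in> part red y" for X x Y y
    using that symp_skew by simp
  show "form red (brk red X Y) Z = form red X (brk red Y Z)"
    if "X \<in> carr red" "Y \<in> carr red" "Z \<in> carr red" for X Y Z
    using that form_invariant[of X Y Z] by (simp add: form_Q red_orth)
  \<comment> \<open>\<omega>(x, e') is a multiple of B(x, e') because \<open>e'\<close> is an
    eigenvector of \<delta>, so it vanishes on \<open>red\<close>.\<close>
  have symp_Q: "symp L x (Q y) = symp L x y" if "x \<in> carr red" "y \<in> carr L" for x y
    using that form_\<delta>[of x e'] by (simp add: Q_def sderD(4) red_orth)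
  show "sg (x * z) * symp red X (brk red Y Z) + sg (y * x) * symp red Y (brk red Z X)
        + sg (z * y) * symp red Z (brk red X Y) = 0"
    if "X \<in> part red x" "Y \<in> part red y" "Z \<in> part red z" for X x Y y Z z
  proof -
    have XYZ: "X \<in> part L x" "Y \<in> part L y" "Z \<in> part L z"
      and [simp]: "X \<in> carr red" "Y \<in> carr red" "Z \<in> carr red"
      using that part_red_carr by auto
    then have [simp]: "X \<in> carr L" "Y \<in> carr L" "Z \<in> carr L"
      by auto
    show ?thesis
      using symp_closed[OF XYZ] by (simp add: symp_Q)
  qed
qed

text \<open>Having \<open>e'\<close> as an eigenvector makes \<open>E\<close> preserve its
  orthogonal complement and descend to the quotient. This is applied to \<delta> with eigenvalue
  \<alpha> and to the bracket with \<open>e\<close>, where the eigenvalue is 0.\<close>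

lemma red_derivation:
  assumes E: "superderivation L d E" "skew_supersymmetric L d E" and Ee': "E e' = c *s e'"
  shows "superderivation red d (\<lambda>x. Q (E x))" "skew_supersymmetric red d (\<lambda>x. Q (E x))"
    and "x \<in> carr red \<Longrightarrow> Q (E x) \<in> carr red"
    and "x \<in> carr L \<Longrightarrow> Q (E (Q x)) = Q (E x)"
proof -
  note [simp] = superderivationD(1,2,5,6)[OF E(1)] Q_linear
  have orth: "form L e' (E x) = 0" if "x \<in> carr red" for x
    using skew_supersymmetricD[OF E(2) e'_odd, of x] red_orth[OF that] Ee' by (cases d) simp_all
  show QEQ: "Q (E (Q x)) = Q (E x)" if "x \<in> carr L" for x
    using that Ee' by (simp add: Q_def[of x])
  show "x \<in> carr red \<Longrightarrow> Q (E x) \<in> carr red"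
    by (intro Q_carr_red) (auto simp: orth red_orth)
  show "superderivation red d (\<lambda>x. Q (E x))"
    unfolding superderivation_def
  proof (intro conjI allI ballI)
    show "linear_map_on (carr red) (smul red) (smul red) (\<lambda>x. Q (E x))"
      by (simp add: linear_map_on_def red_orth)
    show "(\<lambda>x. Q (E x)) ` part red x \<subseteq> part red (x + d)" for x
    proof (rule image_subsetI)
      fix X assume X: "X \<in> part red x"
      then have "E X \<in> part L (x + d)"
        by (intro superderivationD(3)[OF E(1)]) simp
      then show "Q (E X) \<in> part red (x + d)"
        using orth[OF part_red_carr[OF X]] by (rule Q_part_red)
    qed
    show "Q (E (brk red X Y)) = brk red (Q (E X)) Y + smul red (sg (d * x)) (brk red X (Q (E Y)))"
      if X: "X \<in> part red x" and Y: "Y \<in> carr red" for x X Y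
    proof -
      have "X \<in> part L x" "X \<in> carr L" "Y \<in> carr L"
        using X Y part_carr by (auto simp: red_orth)
      then show ?thesis
        by (simp add: QEQ superderivationD(4)[OF E(1)])
    qed
  qed
  show "skew_supersymmetric red d (\<lambda>x. Q (E x))"
    unfolding skew_supersymmetric_def
  proof (intro allI ballI)
    fix x X Y assume X: "X \<in> part red x" and Y: "Y \<in> carr red"
    then show "form red (Q (E X)) Y = - sg (d * x) * form red X (Q (E Y))"
      using skew_supersymmetricD[OF E(2), of X x Y] part_red_carr[OF X] by (simp add: form_Q red_orth)
  qed
qed

text \<open>Both halves of bijectivity rest on \<alpha> being nonzero: it makes the line of
  \<open>e'\<close>, the kernel of \<open>Q\<close>, the image of itself under \<delta>, and it
  keeps preimages under \<delta> orthogonal to \<open>e'\<close>.\<close>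

lemma red_symplectic_derivation: "symplectic_derivation red (\<lambda>x. Q (\<delta> x))"
proof -
  note red = red_derivation[OF sderD(1,2) \<delta>_e']
  have "inj_on (\<lambda>x. Q (\<delta> x)) (carr red)"
  proof (rule inj_onI)
    fix x y assume xy: "x \<in> carr red" "y \<in> carr red" "Q (\<delta> x) = Q (\<delta> y)"
    define k where "k = form L (\<delta> x - \<delta> y) e / \<alpha>"
    have "\<delta> (x - y) = form L (\<delta> x - \<delta> y) e *s e'"
      using xy by (simp add: Q_def red_orth vs.scale_left_diff_distrib algebra_simps)
    then have "\<delta> (x - y) = \<delta> (k *s e')"
      using \<alpha>_nonzero by (simp add: k_def)
    then have *: "x - y = k *s e'"
      using sderD(3) red_orth(5)[OF xy(1)] red_orth(5)[OF xy(2)]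
      by (auto simp: bij_betw_def inj_on_def simp del: \<delta>_simps)
    then have "form L (x - y) e = k"
      by simp
    then have "k = 0"
      using xy red_orth by simp
    with * show "x = y"
      by simp
  qed
  moreover have "\<exists>x\<in>carr red. y = Q (\<delta> x)" if y: "y \<in> carr red" for y
  proof -
    obtain z where z: "z \<in> carr L" "y = \<delta> z"
      using sderD(3) red_orth(5)[OF y] by (auto simp: bij_betw_def)
    have "form L e' z = 0"
      using form_\<delta>[of e' z] z red_orth[OF y] \<alpha>_nonzero by simp
    then have "Q z \<in> carr red"
      using z by (simp add: Q_carr_red)
    moreover have "Q (\<delta> (Q z)) = y"
      using red(4)[OF z(1)] z Q_id red_orth[OF y] by simp
    ultimately show ?thesis
      by metis
  qed
  ultimately have "bij_betw (\<lambda>x. Q (\<delta> x)) (carr red) (carr red)"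
    using red(3) by (auto simp: bij_betw_def)
  then show ?thesis
    unfolding symplectic_derivation_def using red by (auto simp: form_Q red_orth sderD(4))
qed

section \<open>The data of the extension, read off from \<open>e\<close>\<close>

abbreviation "X\<^sub>0 \<equiv> brk L e e"
definition "D x = Q (brk L e x)"
definition "\<mu> = form L (\<delta> e) e"
text \<open>The \<open>red\<close> component of \<delta>(e): by skewness the coefficient of
  \<open>e\<close> is B(e', \<delta>(e)) = -\<alpha>, and that of \<open>e'\<close> is
  \<mu>.\<close>

definition "A\<^sub>1 = \<delta> e + \<alpha> *s e - \<mu> *s e'"

lemma X\<^sub>0_part [simp]: "X\<^sub>0 \<in> part L 0"
  using brk_part[OF e_odd e_odd] by simp

lemma X\<^sub>0_carr [simp]: "X\<^sub>0 \<in> carr red"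
  by (simp add: carr_red)

lemma A\<^sub>1_part: "A\<^sub>1 \<in> part red 1"
proof -
  have "form L e' (\<delta> e) = - \<alpha>"
    using form_\<delta>[of e' e] by simp
  then show ?thesis
    using \<delta>_part[OF e_odd] by (simp add: A\<^sub>1_def \<mu>_def)
qed

lemma \<delta>_e: "\<delta> e = \<mu> *s e' + A\<^sub>1 - \<alpha> *s e"
  by (simp add: A\<^sub>1_def)

lemma A\<^sub>1_carr [simp]: "A\<^sub>1 \<in> carr L"
  using A\<^sub>1_part by (auto intro: part_carr)

lemmas D_derivation =
  red_derivation[OF superderivation_ad[OF e_odd] skew_supersymmetric_ad[OF e_odd], of 0, simplified,
    folded D_def]

lemma Q_expand: "x = Q x + form L x e *s e'"
  by (simp add: Q_def)

text \<open>The left side is the coefficient of \<open>e'\<close> in [x,y]; this is the origin of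
  the terms -B(D(X),Y) and -B(X,X_0) in the bracket of the extension.\<close>

lemma form_brk_e:
  "\<lbrakk>x \<in> carr L; y \<in> carr L\<rbrakk> \<Longrightarrow> form L (brk L x y) e = - form L (brk L e x) y"
  using form_swap_odd[of "brk L x y" e] form_invariant[of e x y] by simp

lemma brk_e_right:
  assumes "x \<in> carr red"
  shows "brk L x e = - brk L e (parity_aut red x)"
proof -
  interpret R: quadratic_symplectic_lie_superalgebra red
    by (rule red_qs)
  obtain x0 x1 where x: "x0 \<in> part red 0" "x1 \<in> part red 1" "x = x0 + x1"
    using R.carr_cases[OF assms] .
  then have x': "x0 \<in> part L 0" "x1 \<in> part L 1"
    by auto
  then show ?thesis
    using brk_skew[OF x'(1) e_odd] brk_skew[OF x'(2) e_odd]
    by (simp add: R.parity_aut_sum[OF x(1,2)] x(3))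
qed

lemma parity_aut_red [simp]:
  assumes "x \<in> carr red"
  shows "parity_aut red x \<in> carr red" "form L (parity_aut red x) X\<^sub>0 = form L x X\<^sub>0"
proof -
  interpret R: quadratic_symplectic_lie_superalgebra red
    by (rule red_qs)
  obtain x0 x1 where x: "x0 \<in> part red 0" "x1 \<in> part red 1" "x = x0 + x1"
    using R.carr_cases[OF assms] .
  then have x': "x0 \<in> part L 0" "x1 \<in> part L 1"
    by auto
  show "parity_aut red x \<in> carr red"
    unfolding x(3) R.parity_aut_sum[OF x(1,2)] using x(1,2) part_red_carr by (intro R.carr_closed(3)) auto
  \<comment> \<open>Only the sign of the odd component changes, and the even X_0 is orthogonal to
    it.\<close>
  show "form L (parity_aut red x) X\<^sub>0 = form L x X\<^sub>0"
    unfolding x(3) R.parity_aut_sum[OF x(1,2)] using x' by simp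
qed

section \<open>The identification with the space of triples\<close>

definition embed :: "'k \<times> 'v \<times> 'k \<Rightarrow> 'v" where
  "embed = (\<lambda>(a, x, b). a *s e + x + b *s e')"

lemma embed_form:
  assumes "x \<in> carr red" "y \<in> carr red"
  shows "form L (embed (a, x, b)) (embed (a', y, b')) = ext_form red (a, x, b) (a', y, b')"
  using assms by (simp add: embed_def ext_form_def red_orth algebra_simps)

lemma embed_\<delta>:
  assumes "x \<in> carr red"
  shows "\<delta> (embed (a, x, b)) =
    embed (- \<alpha> * a, Q (\<delta> x) + a *s A\<^sub>1, \<mu> * a - form L x A\<^sub>1 + \<alpha> * b)"
proof -
  \<comment> \<open>By skewness this is -B(x, \<delta>(e)), and only the component A_1 of
    \<delta>(e) pairs with \<open>x\<close>.\<close>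
  have "form L (\<delta> x) e = - form L x A\<^sub>1"
    using form_\<delta>[of x e] assms by (simp add: \<delta>_e red_orth)
  then have \<delta>x: "\<delta> x = Q (\<delta> x) - form L x A\<^sub>1 *s e'"
    using Q_expand[of "\<delta> x"] by simp
  have "\<delta> (embed (a, x, b)) = a *s \<delta> e + \<delta> x + (\<alpha> * b) *s e'"
    using assms by (simp add: embed_def red_orth mult.commute)
  also have "\<dots> = a *s (\<mu> *s e' + A\<^sub>1 - \<alpha> *s e) + (Q (\<delta> x) - form L x A\<^sub>1 *s e') + (\<alpha> * b) *s e'"
    using \<delta>x \<delta>_e by metis
  finally show ?thesis
    by (simp add: embed_def algebra_simps)
qed

lemma embed_brk:
  assumes x: "x \<in> carr red" and y: "y \<in> carr red"
  shows "brk L (embed (a, x, b)) (embed (a', y, b')) =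
    embed (0, (a * a') *s X\<^sub>0 + a *s D y - a' *s D (parity_aut red x) + brk red x y,
      a' * form L x X\<^sub>0 - a * form L y X\<^sub>0 - form L (D x) y)"
proof -
  have eX: "brk L e z = D z - form L z X\<^sub>0 *s e'" if "z \<in> carr red" for z
    using Q_expand[of "brk L e z"] form_brk_e[of e z] form_swap_even[of z X\<^sub>0] red_orth[OF that]
    by (simp add: D_def)
  have Xe: "brk L x e = - D (parity_aut red x) + form L x X\<^sub>0 *s e'"
    using brk_e_right[OF x] eX[of "parity_aut red x"] x by simp
  have xy: "brk L x y = Q (brk L x y) - form L (D x) y *s e'"
    using Q_expand[of "brk L x y"] form_brk_e[of x y] x y
    by (simp add: form_Q red_orth D_def)
  have "brk L (embed (a, x, b)) (embed (a', y, b')) =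
    (a * a') *s X\<^sub>0 + a *s brk L e y + a' *s brk L x e + brk L x y"
    using x y by (simp add: embed_def red_orth algebra_simps)
  also have "\<dots> = (a * a') *s X\<^sub>0 + a *s (D y - form L y X\<^sub>0 *s e')
      + a' *s (- D (parity_aut red x) + form L x X\<^sub>0 *s e') + (Q (brk L x y) - form L (D x) y *s e')"
    using eX[OF y] Xe xy by metis
  finally show ?thesis
    by (simp add: embed_def algebra_simps)
qed

lemma embed_isomorphism:
  "qs_isomorphism (generalized_ext red (\<lambda>x. Q (\<delta> x)) D X\<^sub>0 \<alpha> \<mu> A\<^sub>1) L embed"
  (is "qs_isomorphism ?E L embed")
  unfolding qs_isomorphism_def
proof (intro conjI allI ballI)
  have carr: "carr ?E = UNIV \<times> carr red \<times> UNIV"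
    by (simp add: generalized_ext_def carr_odd_ext)
  have embed_carr: "embed u \<in> carr L" if "u \<in> carr ?E" for u
    using that by (auto simp: carr embed_def red_orth)
  show "bij_betw embed (carr ?E) (carr L)"
    unfolding bij_betw_def
  proof
    show "inj_on embed (carr ?E)"
    proof (rule inj_onI)
      fix u v assume "u \<in> carr ?E" "v \<in> carr ?E" and eq: "embed u = embed v"
      then obtain a x b a' y b' where uv: "u = (a, x, b)" "v = (a', y, b')" "x \<in> carr red" "y \<in> carr red"
        by (auto simp: carr)
      have "form L e' (embed u) = form L e' (embed v)" "form L (embed u) e = form L (embed v) e"
        using eq by auto
      then have "a = a'" "b = b'"
        using uv by (auto simp: embed_def red_orth)
      with eq show "u = v"
        by (simp add: uv embed_def)
    qed
    show "embed ` carr ?E = carr L"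
    proof
      show "embed ` carr ?E \<subseteq> carr L"
        using embed_carr by blast
      show "carr L \<subseteq> embed ` carr ?E"
      proof
        fix x assume "x \<in> carr L"
        then obtain y where "y \<in> carr red" "x = embed (form L e' x, y, form L x e)"
          by (auto simp: embed_def elim: decompose)
        then show "x \<in> embed ` carr ?E"
          by (auto simp: carr)
      qed
    qed
  qed
  show "linear_map_on (carr ?E) (smul ?E) (smul L) embed"
    unfolding linear_map_on_def carr by (auto simp: generalized_ext_def embed_def algebra_simps)
  show "embed ` part ?E d = part L d" for d
  proof (cases "d = 0")
    case True
    then show ?thesis
      by (force simp: generalized_ext_def embed_def)
  next
    case False
    have "x \<in> embed ` part ?E 1" if x: "x \<in> part L 1" for x
    proof -
      have "x - form L e' x *s e - form L x e *s e' \<in> part red 1"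
        using x form_swap_odd[of x e] by simp
      then show ?thesis
        unfolding generalized_ext_def odd_ext_simps
        by (intro image_eqI[of _ _ "(form L e' x, x - form L e' x *s e - form L x e *s e', form L x e)"])
          (auto simp: embed_def)
    qed
    moreover have "embed u \<in> part L 1" if "u \<in> part ?E 1" for u
      using that by (auto simp: generalized_ext_def embed_def)
    ultimately show ?thesis
      using False by auto
  qed
  fix u v assume "u \<in> carr ?E" "v \<in> carr ?E"
  then obtain a x b a' y b' where uv [simp]: "u = (a, x, b)" "v = (a', y, b')" "x \<in> carr red" "y \<in> carr red"
    by (auto simp: carr)
  show "embed (brk ?E u v) = brk L (embed u) (embed v)"
    by (simp add: embed_brk generalized_ext_def)
  show "form L (embed u) (embed v) = form ?E u v"
    by (simp add: embed_form generalized_ext_def)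
  have x: "x \<in> carr red"
    by simp
  \<comment> \<open>\<open>embed_form\<close> requires the middle component of the image under
    \<delta> to lie in \<open>red\<close>.\<close>
  have "Q (\<delta> x) + a *s A\<^sub>1 \<in> carr red"
    using form_\<delta>[of e' x] A\<^sub>1_part red_orth[OF x] by (simp add: carr_red) (simp add: Q_def)
  then show "symp L (embed u) (embed v) = symp ?E u v"
    using embed_carr[OF \<open>u \<in> carr ?E\<close>] embed_carr[OF \<open>v \<in> carr ?E\<close>]
    by (simp add: sderD(4) embed_\<delta> embed_form generalized_ext_def)
qed

lemma isomorphic_generalized_ext:
  "qs_isomorphic L (generalized_ext red (\<lambda>x. Q (\<delta> x)) D X\<^sub>0 \<alpha> \<mu> A\<^sub>1)" (is "qs_isomorphic L ?E")
proof (rule qs_isomorphism_sym[OF embed_isomorphism])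
  interpret R: quadratic_symplectic_lie_superalgebra red
    by (rule red_qs)
  have carr: "carr ?E = UNIV \<times> carr red \<times> UNIV"
    by (simp add: generalized_ext_def carr_odd_ext)
  show "x + y \<in> carr ?E" if "x \<in> carr ?E" "y \<in> carr ?E" for x y
    using that unfolding carr by (auto intro: R.carr_closed)
  show "smul ?E c x \<in> carr ?E" if "x \<in> carr ?E" for c x
    using that unfolding carr by (auto simp: generalized_ext_def simp flip: red_simps intro: R.carr_closed)
  show "brk ?E x y \<in> carr ?E" if "x \<in> carr ?E" "y \<in> carr ?E" for x y
    using that D_derivation(3) X\<^sub>0_carr R.brk_carr R.carr_closed unfolding carr
    by (auto simp: generalized_ext_def)
  show "part ?E d \<subseteq> carr ?E" for d
    unfolding carr by (cases d) (auto simp: generalized_ext_def part_red_carr)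
qed

text \<open>The Leibniz rule gives [e,[e,e]] = -2 [e,[e,e]], and 3 is invertible in characteristic
  zero.\<close>

lemma brk_e_X\<^sub>0: "brk L e X\<^sub>0 = 0"
proof -
  have "brk L e X\<^sub>0 = - (brk L e X\<^sub>0) - brk L e X\<^sub>0"
    using superderivationD(4)[OF superderivation_ad[OF e_odd] e_odd, of e] brk_swap_even[of e X\<^sub>0]
    by simp
  then have "brk L e X\<^sub>0 + brk L e X\<^sub>0 + brk L e X\<^sub>0 = 0"
    by (simp add: algebra_simps)
  moreover have "(1 + 1 + 1) *s brk L e X\<^sub>0 = brk L e X\<^sub>0 + brk L e X\<^sub>0 + brk L e X\<^sub>0"
    by (simp only: vs.scale_left_distrib vs.scale_one)
  ultimately have "3 *s brk L e X\<^sub>0 = 0"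
    by simp
  then show ?thesis
    by (simp add: vs.scale_eq_0_iff)
qed

lemma D_X\<^sub>0: "D X\<^sub>0 = 0"
  by (simp add: D_def brk_e_X\<^sub>0)

lemma half_double: "(1 / 2) *s (x + x) = x"
  using vs.scale_left_distrib[of "1 / 2" "1 / 2" x] by (simp add: vs.scale_right_distrib)

text \<open>The Leibniz rule for the odd element \<open>e\<close> reads [e,[e,x]] = [X_0,x] -
  [e,[e,x]].\<close>

lemma D_square:
  assumes "x \<in> carr red"
  shows "D (D x) = (1 / 2) *s brk red X\<^sub>0 x"
proof -
  have x: "x \<in> carr L"
    using assms by (rule red_orth)
  have "brk L e (brk L e x) = brk L X\<^sub>0 x - brk L e (brk L e x)"
    using superderivationD(4)[OF superderivation_ad[OF e_odd] e_odd x] by simp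
  then have "brk L X\<^sub>0 x = brk L e (brk L e x) + brk L e (brk L e x)"
    by (simp add: algebra_simps)
  then have "(1 / 2) *s brk L X\<^sub>0 x = brk L e (brk L e x)"
    by (simp only: half_double)
  then show ?thesis
    using x by (simp add: D_def flip: Q_linear(2))
qed

lemma form_X\<^sub>0: "form L X\<^sub>0 X\<^sub>0 = 0"
  by (simp add: form_invariant brk_e_X\<^sub>0)

text \<open>By the Leibniz rule, \<delta>[e,x] - [e,\<delta>(x)] = [\<delta>(e),x], and \<delta>(e)
  is A_1 - \<alpha> e up to a central term.\<close>

lemma D_commutator:
  assumes "x \<in> carr red"
  shows "Q (\<delta> (D x)) - D (Q (\<delta> x)) + \<alpha> *s D x = brk red A\<^sub>1 x"
proof -
  have x: "x \<in> carr L"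
    using assms by (rule red_orth)
  have "Q (\<delta> (D x)) = Q (\<delta> (brk L e x))"
    unfolding D_def using x by (intro red_derivation(4)[OF sderD(1,2) \<delta>_e']) simp
  moreover have "D (Q (\<delta> x)) = Q (brk L e (\<delta> x))"
    using x by (simp add: D_def)
  moreover have "\<delta> (brk L e x) - brk L e (\<delta> x) + \<alpha> *s brk L e x = brk L A\<^sub>1 x"
    using x by (simp add: \<delta>_brk A\<^sub>1_def)
  ultimately show ?thesis
    using x by (simp add: D_def flip: Q_linear)
qed

text \<open>The Leibniz rule gives \<delta>(X_0) = 2 [e,\<delta>(e)], and [e,A_1] exceeds
  [e,\<delta>(e)] by \<alpha> X_0. All these terms are even, so \<open>Q\<close> fixes them.\<close>

lemma D_A\<^sub>1: "D A\<^sub>1 = \<alpha> *s X\<^sub>0 + (1 / 2) *s Q (\<delta> X\<^sub>0)"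
proof -
  have "\<delta> X\<^sub>0 = brk L e (\<delta> e) + brk L e (\<delta> e)"
    using \<delta>_brk[of e e] brk_swap_odd[OF \<delta>_part[OF e_odd] e_odd] by simp
  then have "(1 / 2) *s \<delta> X\<^sub>0 = brk L e (\<delta> e)"
    by (simp only: half_double)
  moreover have "Q (\<delta> X\<^sub>0) = \<delta> X\<^sub>0"
    by (intro Q_even \<delta>_part) simp
  moreover have "brk L e A\<^sub>1 = brk L e (\<delta> e) + \<alpha> *s X\<^sub>0"
    by (simp add: A\<^sub>1_def)
  moreover have "Q (brk L e A\<^sub>1) = brk L e A\<^sub>1"
    using A\<^sub>1_part brk_degrees(4)[OF e_odd, of A\<^sub>1] by (intro Q_even) auto
  ultimately show ?thesis
    by (simp add: D_def add.commute)
qed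

section \<open>The flag of the reduction\<close>

text \<open>\<open>W V i\<close> represents $V_{i+1} / \mathbb{K}e^*$.\<close>

definition W :: "(nat \<Rightarrow> 'v set) \<Rightarrow> nat \<Rightarrow> 'v set" where
  "W V i = {x \<in> V (Suc i). form L x e = 0}"

text \<open>Dropping \<open>e\<close> and \<open>e'\<close> lowers the dimension of the odd part
  from \<open>n + 2\<close> to \<open>n\<close>: the flag loses one step at each end.\<close>

context
  fixes n V
  assumes flag: "filiform_flag L (Suc (Suc n)) V"
    and e'_V: "e' \<in> V 1"
    and perp: "V (Suc n) = {x \<in> part L 1. form L e' x = 0}"
begin

lemma flag_below_top:
  "i \<le> Suc n \<Longrightarrow> V i \<subseteq> V (Suc n)" "i \<le> Suc n \<Longrightarrow> 0 < i \<Longrightarrow> e' \<in> V i"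
  "\<lbrakk>i \<le> Suc n; v \<in> V i\<rbrakk> \<Longrightarrow> v \<in> part L 1" "\<lbrakk>i \<le> Suc n; v \<in> V i\<rbrakk> \<Longrightarrow> form L e' v = 0"
proof -
  show *: "i \<le> Suc n \<Longrightarrow> V i \<subseteq> V (Suc n)"
    by (rule filiform_flag_mono[OF flag]) simp_all
  show "i \<le> Suc n \<Longrightarrow> 0 < i \<Longrightarrow> e' \<in> V i"
    using filiform_flag_mono[OF flag, of 1 i] e'_V by auto
  show "\<lbrakk>i \<le> Suc n; v \<in> V i\<rbrakk> \<Longrightarrow> v \<in> part L 1" "\<lbrakk>i \<le> Suc n; v \<in> V i\<rbrakk> \<Longrightarrow> form L e' v = 0"
    using * perp by auto
qed

lemma W_subspace:
  assumes "i \<le> n"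
  shows "vs.subspace (W V i)"
proof (rule vs.subspaceI)
  have sub: "vs.subspace (V (Suc i))"
    using assms by (intro filiform_flagD(3)[OF flag]) simp
  have carr: "x \<in> carr L" if "x \<in> V (Suc i)" for x
    using flag_below_top(3)[of "Suc i" x] assms that part_carr by auto
  show "0 \<in> W V i"
    using sub by (simp add: W_def vs.subspace_0)
  show "x + y \<in> W V i" if "x \<in> W V i" "y \<in> W V i" for x y
    using sub carr that by (simp add: W_def vs.subspace_add)
  show "c *s x \<in> W V i" if "x \<in> W V i" for c x
    using sub carr that by (simp add: W_def vs.subspace_scale)
qed

text \<open>The functional B(., e) is nonzero on V_{i+1}, which contains \<open>e'\<close>.\<close>

lemma W_dim:
  assumes "i \<le> n"
  shows "vs.dim (W V i) = i"
  unfolding W_def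
proof (rule vs.dim_kernel_of_functional)
  have carr: "x \<in> carr L" if "x \<in> V (Suc i)" for x
    using flag_below_top(3)[of "Suc i" x] assms that part_carr by auto
  show "form L (x - y) e = form L x e - form L y e" if "x \<in> V (Suc i)" "y \<in> V (Suc i)" for x y
    using that carr by simp
  show "form L (c *s x) e = c * form L x e" if "x \<in> V (Suc i)" for c x
    using that carr by simp
  show "vs.subspace {x \<in> V (Suc i). form L x e = 0}"
    using W_subspace[OF assms] by (simp add: W_def)
qed (use assms filiform_flagD(3,4)[OF flag, of "Suc i"] flag_below_top(2)[of "Suc i"] in auto)

lemma W_top: "W V n = part red 1"
  by (auto simp: W_def perp)

lemma Q_in_W:
  assumes "i \<le> n" "x \<in> V (Suc i)"
  shows "Q x \<in> W V i"
proof -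
  have sub: "vs.subspace (V (Suc i))"
    using assms by (intro filiform_flagD(3)[OF flag]) simp
  have "x \<in> carr L"
    using flag_below_top(3)[of "Suc i" x] assms part_carr by auto
  moreover have "Q x \<in> V (Suc i)"
    unfolding Q_def using assms sub flag_below_top(2)[of "Suc i"]
    by (intro vs.subspace_diff vs.subspace_scale) auto
  ultimately show ?thesis
    by (simp add: W_def) (simp add: Q_def)
qed

lemma W_flag:
  assumes "n > 0"
  shows "filiform_flag red n (W V)"
  unfolding filiform_flag_def
proof (intro conjI allI impI)
  show "n > 0" "W V n = part red 1"
    by (fact assms, fact W_top)
  show "module.subspace (smul red) (W V i)" "vector_space.dim (smul red) (W V i) = i" if "i \<le> n" for i
    using that W_subspace W_dim by simp_all
  fix i assume i: "i < n"
  have "W V i \<subseteq> W V (Suc i)"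
    using filiform_flag_mono[OF flag, of "Suc i" "Suc (Suc i)"] i by (auto simp: W_def)
  moreover have "W V i \<noteq> W V (Suc i)"
    using W_dim[of i] W_dim[of "Suc i"] i by auto
  ultimately show "W V i \<subset> W V (Suc i)"
    by blast
  let ?S = "{brk red X v | X v. X \<in> part red 0 \<and> v \<in> W V (Suc i)}"
  have "vs.span ?S = W V i"
  proof
    have "?S \<subseteq> W V i"
    proof clarify
      fix X v assume "X \<in> part red 0" "v \<in> W V (Suc i)"
      then have "brk L X v \<in> V (Suc i)"
        using i by (intro filiform_flagD(7)[OF flag]) (auto simp: W_def)
      then show "brk red X v \<in> W V i"
        using Q_in_W[of i] i by simp
    qed
    then show "vs.span ?S \<subseteq> W V i"
      using W_subspace[of i] i by (intro vs.span_minimal) auto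
    \<comment> \<open>\<open>Q\<close> fixes \<open>W V i\<close>, so it suffices to push the
      brackets spanning V_{i+1} through \<open>Q\<close>; replacing \<open>v\<close> by
      \<open>Q v\<close> inside a bracket changes nothing.\<close>
    have "Q x \<in> vs.span ?S" if "x \<in> V (Suc i)" for x
    proof -
      have "x \<in> vs.span {brk L X v | X v. X \<in> part L 0 \<and> v \<in> V (Suc (Suc i))}"
        using that i filiform_flagD(6)[OF flag, of "Suc i"] by simp
      then have "x \<in> carr L \<and> Q x \<in> vs.span ?S"
      proof (induction rule: vs.span_induct_alt)
        case base
        then show ?case
          by (simp add: vs.span_zero)
      next
        case (step c x y)
        then obtain X v where x: "x = brk L X v" "X \<in> part L 0" "v \<in> V (Suc (Suc i))"
          by blast
        have v: "v \<in> part L 1" "Q v \<in> W V (Suc i)"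
          using x(3) i flag_below_top(3)[of "Suc (Suc i)" v] Q_in_W[of "Suc i" v] by auto
        have "brk red X (Q v) \<in> vs.span ?S"
        proof (rule vs.span_base)
          have "X \<in> part red 0"
            using x(2) by simp
          then show "brk red X (Q v) \<in> ?S"
            using v(2) by blast
        qed
        then have "Q x \<in> vs.span ?S"
          using x v by simp
        then show ?case
          using step.IH x v by (simp add: Q_linear vs.span_add vs.span_scale)
      qed
      then show ?thesis ..
    qed
    then show "W V i \<subseteq> vs.span ?S"
      using Q_id by (force simp: W_def)
  qed
  then show "module.span (smul red) ?S = W V i"
    by simp
qed

lemma e_notin_V: "e \<notin> V (Suc n)"
  by (simp add: perp)

text \<open>[X,e] can be chosen outside \<open>V n\<close>. Projecting it changes it by a multiple
  of \<open>e'\<close>, which lies in \<open>V n\<close> as \<open>n\<close> is positive, so the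
  image stays outside.\<close>

lemma D_image:
  assumes "n > 0"
  shows "D ` part red 0 \<inter> (W V n - W V (n - 1)) \<noteq> {}"
proof -
  obtain X where X: "X \<in> part L 0" "brk L X e \<notin> V n"
    using filiform_brk_outside[OF flag e_odd e_notin_V] .
  have "brk L X e \<in> V (Suc n)"
    using filiform_flagD(2,7)[OF flag] X(1) e_odd by auto
  moreover have eX: "brk L e X = - brk L X e"
    using X(1) by (intro brk_swap_even) simp_all
  ultimately have "brk L e X \<in> V (Suc n)"
    using filiform_flagD(3)[OF flag, of "Suc n"] by (simp add: vs.subspace_neg)
  then have "D X \<in> W V n"
    unfolding D_def by (intro Q_in_W) simp_all
  moreover have "D X \<notin> W V (n - 1)"
  proof
    assume "D X \<in> W V (n - 1)"
    then have "D X \<in> V n"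
      using assms by (simp add: W_def)
    then have "D X + form L (brk L e X) e *s e' \<in> V n"
      using filiform_flagD(3)[OF flag, of n] flag_below_top(2)[of n] assms
      by (intro vs.subspace_add vs.subspace_scale) auto
    then have "- brk L X e \<in> V n"
      by (simp add: D_def Q_def eX)
    then show False
      using X(2) vs.subspace_neg[OF filiform_flagD(3)[OF flag, of n], of "- brk L X e"] by simp
  qed
  moreover have "X \<in> part red 0"
    using X by simp
  ultimately show ?thesis
    by blast
qed

lemma generalized_step:
  assumes "n > 0" "X\<^sub>0 \<noteq> 0"
  shows "generalized_double_extension red L"
  unfolding generalized_double_extension_def
proof (intro conjI exI)
  show "quadratic_symplectic_lie_superalgebra red"
    by (rule red_qs)
  show "filiform_flag red n (W V)"
    by (rule W_flag) fact
  show "symplectic_derivation red (\<lambda>x. Q (\<delta> x))"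
    by (rule red_symplectic_derivation)
  show "superderivation red 1 D" "skew_supersymmetric red 1 D"
    using D_derivation(1,2) by simp_all
  show "X\<^sub>0 \<in> part red 0 - {0}" "D X\<^sub>0 = 0" "form red X\<^sub>0 X\<^sub>0 = 0"
    using assms D_X\<^sub>0 form_X\<^sub>0 by simp_all
  show "\<forall>X\<in>carr red. D (D X) = smul red (1 / 2) (brk red X\<^sub>0 X)"
    using D_square by simp
  show "D ` part red 0 \<inter> (W V n - W V (n - 1)) \<noteq> {}"
    by (rule D_image) fact
  show "\<alpha> \<noteq> 0" "A\<^sub>1 \<in> part red 1"
    by (fact \<alpha>_nonzero, fact A\<^sub>1_part)
  show "\<forall>X\<in>carr red. Q (\<delta> (D X)) - D (Q (\<delta> X)) + smul red \<alpha> (D X) = brk red A\<^sub>1 X"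
    using D_commutator by simp
  show "D A\<^sub>1 = smul red \<alpha> X\<^sub>0 + smul red (1 / 2) (Q (\<delta> X\<^sub>0))"
    using D_A\<^sub>1 by simp
  show "qs_isomorphic L (generalized_ext red (\<lambda>x. Q (\<delta> x)) D X\<^sub>0 \<alpha> \<mu> A\<^sub>1)"
    by (rule isomorphic_generalized_ext)
qed

end

text \<open>\<open>D\<close> reverses parity and \<open>red\<close> has no odd part, so
  \<open>D\<close> vanishes on \<open>red\<close> and A_1 = 0. With \<mu> = 0, \<delta>(e) has no
  \<open>e'\<close> term left, as in the elementary extension.\<close>

lemma elementary_step:
  assumes odd: "part red 1 = {0}" and "X\<^sub>0 \<noteq> 0" and \<mu>: "\<mu> = 0"
  shows "quadratic_symplectic_lie_algebra red" "elementary_odd_double_extension red L"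
proof -
  interpret R: quadratic_symplectic_lie_superalgebra red
    by (rule red_qs)
  show alg: "quadratic_symplectic_lie_algebra red"
    by (intro quadratic_symplectic_lie_algebra.intro red_qs quadratic_symplectic_lie_algebra_axioms.intro odd)
  have D0: "D x = 0" if "x \<in> carr red" for x
  proof -
    have "x \<in> part red 0"
      using that odd by (auto elim!: R.carr_cases simp del: red_simps)
    then have "D x \<in> part red 1"
      using R.superderivationD(3)[OF D_derivation(1), of x 0] by simp
    then show ?thesis
      using odd by blast
  qed
  have A1: "A\<^sub>1 = 0"
    using A\<^sub>1_part odd by blast
  \<comment> \<open>Forced by the elementary extension, where the eigenvalue of \<delta> on e^* is
    -\<beta>/2.\<close>
  define \<beta> where "\<beta> = - 2 * \<alpha>"
  let ?E = "generalized_ext red (\<lambda>x. Q (\<delta> x)) D X\<^sub>0 \<alpha> \<mu> A\<^sub>1"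
  let ?F = "elementary_ext red (\<lambda>x. Q (\<delta> x)) X\<^sub>0 \<beta>"
  have carr: "carr ?E = UNIV \<times> carr red \<times> UNIV" "carr ?F = UNIV \<times> carr red \<times> UNIV"
    by (simp_all add: generalized_ext_def elementary_ext_def carr_odd_ext)
  have same: "smul ?F = smul ?E" "part ?F = part ?E" "form ?F = form ?E"
    by (simp_all add: generalized_ext_def elementary_ext_def odd_ext_def)
  \<comment> \<open>The two structures are compared only on the carrier, where \<open>D\<close>
    vanishes, so the isomorphism is transferred instead of the records being identified.\<close>
  have eq: "brk ?F u v = brk ?E u v" "symp ?F u v = symp ?E u v"
    if mem: "u \<in> carr ?E" "v \<in> carr ?E" for u v
  proof -
    obtain a x b a' y b' where uv: "u = (a, x, b)" "v = (a', y, b')" and x: "x \<in> carr red" and y: "y \<in> carr red"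
      using mem unfolding carr by blast
    have zero: "D x = 0" "D y = 0" "D (parity_aut red x) = 0" "form L 0 y = 0" "form L x 0 = 0"
      using x y red_orth(5)[OF x] red_orth(5)[OF y] by (simp_all add: D0)
    show "brk ?F u v = brk ?E u v" "symp ?F u v = symp ?E u v"
      by (simp_all add: uv generalized_ext_def elementary_ext_def zero A1 \<mu> \<beta>_def)
  qed
  obtain f where f: "qs_isomorphism L ?E f"
    using isomorphic_generalized_ext by (auto simp: qs_isomorphic_def)
  then have "f x \<in> carr ?E" if "x \<in> carr L" for x
    using that by (auto simp: qs_isomorphism_def bij_betw_def)
  with f have "qs_isomorphism L ?F f"
    unfolding qs_isomorphism_def by (simp add: same eq carr)
  then have iso: "qs_isomorphic L ?F"
    by (auto simp: qs_isomorphic_def)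
  have "0 = \<alpha> *s X\<^sub>0 + (1 / 2) *s Q (\<delta> X\<^sub>0)"
    using D_A\<^sub>1 D0[of 0] by (simp add: A1)
  then have "2 *s 0 = 2 *s (\<alpha> *s X\<^sub>0 + (1 / 2) *s Q (\<delta> X\<^sub>0))"
    by simp
  then have "0 = (2 * \<alpha>) *s X\<^sub>0 + Q (\<delta> X\<^sub>0)"
    by (simp add: vs.scale_right_distrib)
  then have \<delta>X: "Q (\<delta> X\<^sub>0) = \<beta> *s X\<^sub>0"
    by (simp add: \<beta>_def eq_neg_iff_add_eq_0 add.commute)
  \<comment> \<open>X_0 is central because its bracket is twice the square of
    \<open>D\<close>.\<close>
  have "brk red X\<^sub>0 Y = 0" if Y: "Y \<in> carr red" for Y
  proof -
    have "(1 / 2) *s brk red X\<^sub>0 Y = 0"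
      using D_square[OF Y] D0[OF Y] D0[of 0] by simp
    then show ?thesis
      by (simp add: vs.scale_eq_0_iff del: red_simps)
  qed
  then have "X\<^sub>0 \<in> lie_center red - {0}"
    using assms(2) X\<^sub>0_carr unfolding lie_center_def by blast
  moreover have "\<beta> \<noteq> 0"
    using \<alpha>_nonzero by (simp add: \<beta>_def)
  ultimately show "elementary_odd_double_extension red L"
    unfolding elementary_odd_double_extension_def
    using alg iso red_symplectic_derivation form_X\<^sub>0 \<delta>X
    by (intro conjI exI[of _ "\<lambda>x. Q (\<delta> x)"] exI[of _ X\<^sub>0] exI[of _ \<beta>]) simp_all
qed

end

section \<open>Choice of the splitting, and the induction\<close>

lemma ex_odd_splitting:
  fixes L :: "('k::field_char_0, 'v::ab_group_add) qs_struct"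
  assumes qs: "quadratic_symplectic_lie_superalgebra L"
    and sd: "symplectic_derivation L \<delta>" and flag: "filiform_flag L m V"
  obtains n e e' \<alpha> where "m = Suc (Suc n)" "odd_splitting L \<delta> e e' \<alpha>" "brk L e e \<noteq> 0"
    "form L (\<delta> e) e = 0" "\<forall>x\<in>V 1. \<exists>k. x = smul L k e'" "e' \<in> V 1"
    "V (Suc n) = {x \<in> part L 1. form L e' x = 0}"
proof -
  interpret quadratic_symplectic_lie_superalgebra L
    by (rule qs)
  note fl = filiform_flagD[OF flag]
  note V0 = filiform_flag_zero[OF flag]
  obtain B where B: "B \<subseteq> V 1" "vs.independent B" "V 1 \<subseteq> vs.span B" "card B = 1"
    using vs.basis_exists[of "V 1"] fl(1) fl(4)[of 1] by (metis One_nat_def Suc_leI)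
  then obtain f where Bf: "B = {f}"
    by (auto simp: card_1_singleton_iff)
  have f0: "f \<noteq> 0"
    using B(2) vs.dependent_zero[of B] Bf by auto
  have f_V: "f \<in> V 1" and V1: "\<And>x. x \<in> V 1 \<Longrightarrow> \<exists>k. x = k *s f"
    using B Bf by (auto simp: vs.span_singleton)
  have f_odd: "f \<in> part L 1"
    using f_V filiform_flag_mono[OF flag, of 1 m] fl(1,2) by auto
  have even_f: "brk L x f = 0" if "x \<in> part L 0" for x
    using fl(7)[of 0 x f] fl(1) that f_V V0 by simp
  obtain m' where m': "m = Suc m'"
    using fl(1) by (cases m) auto
  have perp: "form L f v = 0" if "v \<in> V m'" for v
    using orthogonal_if_centralizes_even[OF f_odd even_f flag[unfolded m'] that] .
  \<comment> \<open>Otherwise the odd part is the line of \<open>f\<close>, on which B vanishes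
    although it must be non-degenerate there.\<close>
  have "m' \<noteq> 0"
  proof
    assume "m' = 0"
    then have "form L f y = 0" if "y \<in> part L 1" for y
      using that V1[of y] fl(2) m' f_odd form_odd_self[OF f_odd] by auto
    then show False
      using f0 form_eq_zeroD_odd[OF f_odd] by blast
  qed
  then obtain n where n: "m' = Suc n"
    by (cases m') auto
  have m: "m = Suc (Suc n)"
    using m' n by simp
  note perp = perp[unfolded n]
  obtain e0 where e0: "e0 \<in> part L 1" "e0 \<notin> V (Suc n)" "brk L e0 e0 \<noteq> 0"
    using ex_odd_with_nonzero_square[OF flag[unfolded m]] .
  have dec: "\<exists>k v. v \<in> V (Suc n) \<and> x = v + k *s e0" if "x \<in> part L 1" for x
    using filiform_flag_decomposition[OF flag[unfolded m] e0(1,2) that] by metis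
  have V_odd: "v \<in> part L 1" if "v \<in> V (Suc n)" for v
    using that fl(2) fl(5)[of "Suc n"] m by auto
  have V_carr: "v \<in> carr L" if "v \<in> V (Suc n)" for v
    using V_odd[OF that] by simp
  have fe: "form L f e0 \<noteq> 0"
  proof
    assume *: "form L f e0 = 0"
    have "form L f x = 0" if x: "x \<in> part L 1" for x
    proof -
      obtain k v where "v \<in> V (Suc n)" "x = v + k *s e0"
        using dec[OF x] by blast
      then show ?thesis
        using * perp V_carr e0(1) f_odd by simp
    qed
    then show False
      using f0 form_eq_zeroD_odd[OF f_odd] by blast
  qed
  define e' where "e' = (1 / form L f e0) *s f"
  have e'_odd: "e' \<in> part L 1" and e'e: "form L e' e0 = 1" and e'_perp: "\<And>v. v \<in> V (Suc n) \<Longrightarrow> form L e' v = 0"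
    and even_e': "\<And>x. x \<in> part L 0 \<Longrightarrow> brk L x e' = 0"
    using f_odd fe e0(1) perp V_carr even_f by (simp_all add: e'_def)
  have e'_V: "e' \<in> V 1"
    unfolding e'_def using f_V fl(1) by (intro vs.subspace_scale fl(3)) auto
  have V1': "\<forall>x\<in>V 1. \<exists>k. x = k *s e'"
  proof
    fix x assume "x \<in> V 1"
    then obtain k where "x = k *s f"
      using V1 by blast
    then have "x = (k * form L f e0) *s e'"
      using fe by (simp add: e'_def)
    then show "\<exists>k. x = k *s e'" ..
  qed
  have top: "V (Suc n) = {x \<in> part L 1. form L e' x = 0}"
  proof
    show "V (Suc n) \<subseteq> {x \<in> part L 1. form L e' x = 0}"
      using V_odd e'_perp by blast
    show "{x \<in> part L 1. form L e' x = 0} \<subseteq> V (Suc n)"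
    proof clarify
      fix x assume x: "x \<in> part L 1" "form L e' x = 0"
      then obtain k v where kv: "v \<in> V (Suc n)" "x = v + k *s e0"
        using dec by blast
      then have "k = 0"
        using x e'_odd e'e e'_perp V_carr e0(1) by simp
      then show "x \<in> V (Suc n)"
        using kv by simp
    qed
  qed
  have brk_e': "brk L e' x = 0" if "x \<in> carr L" for x
  proof -
    have "brk L e' y = 0" if y: "y \<in> part L 0" for y
      using brk_swap_even[of e' y] even_e'[OF y] y e'_odd by simp
    \<comment> \<open>The bracket is even, so it is tested against even \<open>z0\<close>:
      B([e',y],z0) = -B(e',[z0,y]) = -B([e',z0],y) = 0.\<close>
    moreover have "brk L e' y = 0" if y: "y \<in> part L 1" for y
    proof (rule form_eq_zeroD)
      fix z assume "z \<in> carr L"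
      then obtain z0 z1 where z: "z0 \<in> part L 0" "z1 \<in> part L 1" "z = z0 + z1"
        by (rule carr_cases)
      have "form L (brk L e' y) z0 = form L e' (- brk L z0 y)"
        using form_invariant[of e' y z0] brk_swap_even[of y z0] y z e'_odd by simp
      also have "\<dots> = - form L (brk L e' z0) y"
        using form_invariant[of e' z0 y] y z e'_odd by simp
      also have "\<dots> = 0"
        using brk_swap_even[of e' z0] even_e'[OF z(1)] y z e'_odd by simp
      finally show "form L (brk L e' y) z = 0"
        using z y e'_odd brk_degrees(4)[OF e'_odd y] by simp
    qed (use y e'_odd in simp)
    ultimately show ?thesis
      using that e'_odd by (elim carr_cases) simp
  qed
  define \<alpha> where "\<alpha> = form L (\<delta> e') e0"
  have \<delta>: "superderivation L 0 \<delta>" "skew_supersymmetric L 0 \<delta>"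
    using sd by (auto simp: symplectic_derivation_def)
  have \<delta>_odd: "\<delta> x \<in> part L 1" if "x \<in> part L 1" for x
    using superderivationD(3)[OF \<delta>(1) that] by simp
  have \<delta>e': "\<delta> e' = \<alpha> *s e'"
  proof -
    \<comment> \<open>Applying \<delta> to [x,e'] = 0 shows that \<delta>(e') commutes with the even
      part, so it is orthogonal to the same hyperplane as \<open>e'\<close>; its value on
      \<open>e0\<close> then determines it.\<close>
    have "brk L x (\<delta> e') = 0" if x: "x \<in> part L 0" for x
    proof -
      have "\<delta> (brk L x e') = brk L (\<delta> x) e' + brk L x (\<delta> e')"
        using superderivationD(4)[OF \<delta>(1) x, of e'] e'_odd by simp
      moreover have "brk L (\<delta> x) e' = 0"
        using superderivationD(3)[OF \<delta>(1) x] by (intro even_e') simp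
      moreover have "\<delta> 0 = 0"
        using superderivationD(2)[OF \<delta>(1), of 0 0] by simp
      ultimately show ?thesis
        using even_e'[OF x] by simp
    qed
    then have perp': "form L (\<delta> e') v = 0" if "v \<in> V (Suc n)" for v
      using orthogonal_if_centralizes_even[OF \<delta>_odd[OF e'_odd] _ flag[unfolded m] that] by blast
    have "\<delta> e' - \<alpha> *s e' = 0"
    proof (rule form_eq_zeroD_odd)
      show "\<delta> e' - \<alpha> *s e' \<in> part L 1"
        using \<delta>_odd e'_odd by simp
      fix x assume "x \<in> part L 1"
      then obtain k v where "v \<in> V (Suc n)" "x = v + k *s e0"
        using dec by blast
      then show "form L (\<delta> e' - \<alpha> *s e') x = 0"
        using \<delta>_odd[OF e'_odd] e'_odd e'e e'_perp perp' V_carr e0(1) by (simp add: \<alpha>_def)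
    qed
    then show ?thesis
      by simp
  qed
  \<comment> \<open>Needed twice: for \<open>e0\<close>, to learn that \<alpha> is nonzero and can
    be divided by, and for the corrected \<open>e\<close>.\<close>
  have splitting: "odd_splitting L \<delta> e e' \<alpha>" if "e \<in> part L 1" "form L e' e = 1" for e
    by unfold_locales (use that sd e'_odd brk_e' \<delta>e' in auto)
  interpret S: odd_splitting L \<delta> e0 e' \<alpha>
    using splitting e0(1) e'e by blast
  \<comment> \<open>$B(\delta(e_0 + c e^*), e_0 + c e^*) = B(\delta(e_0), e_0) + 2 \alpha c$\<close>
  define c where "c = - form L (\<delta> e0) e0 / (2 * \<alpha>)"
  define e where "e = e0 + c *s e'"
  have "form L (\<delta> e) e = 0"
    using S.\<alpha>_nonzero S.form_\<delta>[of e0 e'] by (simp add: e_def c_def field_simps)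
  moreover have "brk L e e \<noteq> 0"
    using e0(3) by (simp add: e_def)
  moreover have "odd_splitting L \<delta> e e' \<alpha>"
    by (rule splitting) (simp_all add: e_def)
  ultimately show ?thesis
    using that m V1' e'_V top by blast
qed

text \<open>Each reduction lowers \<open>m\<close> by two, hence the strong induction; \<delta> is
  generalized because the reduction carries its own projected derivation.\<close>

lemma filiform_obtained_by_extensions:
  fixes L :: "('k::field_char_0, 'v::ab_group_add) qs_struct"
  assumes "quadratic_symplectic_lie_superalgebra L" "symplectic_derivation L \<delta>" "filiform_flag L m V"
  shows "\<exists>(H :: ('k, 'v) qs_struct) (M :: ('k, 'v) qs_struct).
    quadratic_symplectic_lie_algebra H \<and> elementary_odd_double_extension H M \<and>
    generalized_double_extension\<^sup>*\<^sup>* M L"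
  using assms
proof (induction m arbitrary: L \<delta> V rule: less_induct)
  case (less m)
  obtain n e e' \<alpha> where n: "m = Suc (Suc n)" and split: "odd_splitting L \<delta> e e' \<alpha>"
    and ee: "brk L e e \<noteq> 0" and \<mu>: "form L (\<delta> e) e = 0"
    and V1: "\<forall>x\<in>V 1. \<exists>k. x = smul L k e'" "e' \<in> V 1"
    and top: "V (Suc n) = {x \<in> part L 1. form L e' x = 0}"
    by (rule ex_odd_splitting[OF less.prems])
  interpret odd_splitting L \<delta> e e' \<alpha>
    by (rule split)
  note flag = less.prems(3)[unfolded n]
  show ?case
  proof (cases "n = 0")
    case True
    have "part red 1 = {0}"
    proof -
      \<comment> \<open>For \<open>n = 0\<close> the hyperplane is \<open>V 1\<close>, the line of
        \<open>e'\<close>, and only 0 on that line is orthogonal to \<open>e\<close>.\<close>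
      have "x = 0" if "x \<in> part red 1" for x
      proof -
        have "x \<in> V 1"
          using that top True by simp
        then obtain k where "x = smul L k e'"
          using V1(1) by blast
        then show ?thesis
          using that by simp
      qed
      moreover have "0 \<in> part red 1"
        by simp
      ultimately show ?thesis
        by blast
    qed
    then have "quadratic_symplectic_lie_algebra red" "elementary_odd_double_extension red L"
      using elementary_step ee \<mu> by (simp_all only: \<mu>_def not_False_eq_True)
    then show ?thesis
      by blast
  next
    case False
    then have "filiform_flag red n (W V)"
      using W_flag[OF flag V1(2) top] by simp
    then obtain H M :: "('k, 'v) qs_struct" where "quadratic_symplectic_lie_algebra H"
      "elementary_odd_double_extension H M" "generalized_double_extension\<^sup>*\<^sup>* M red"
      using less.IH[OF _ red_qs red_symplectic_derivation, of n "W V"] n by auto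
    moreover have "generalized_double_extension red L"
      using generalized_step[OF flag V1(2) top] False ee by simp
    ultimately show ?thesis
      by (blast intro: rtranclp.rtrancl_into_rtrancl)
  qed
qed

theorem corollary5p1:
  fixes G :: "('k::field_char_0, 'v::ab_group_add) qs_struct"
  assumes "quadratic_symplectic_lie_superalgebra G"
    and "finite_dimensional G"
    and "filiform_type G"
  shows "\<exists>(H :: ('k, 'v) qs_struct) (M :: ('k, 'v) qs_struct).
           quadratic_symplectic_lie_algebra H \<and>
           elementary_odd_double_extension H M \<and>
           generalized_double_extension\<^sup>*\<^sup>* M G"
proof -
  obtain \<delta> where "symplectic_derivation G \<delta>"
    using quadratic_symplectic_lie_superalgebra.ex_symplectic_derivation[OF assms(1,2)] ..
  moreover obtain m V where "filiform_flag G m V"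
    using assms(3) by (auto simp: filiform_type_def)
  ultimately show ?thesis
    using filiform_obtained_by_extensions[OF assms(1)] by blast
qed

end
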